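(* Let $X=aF_1+bF_2$ with $a,b\in\mathbb R$, let $V$ be any Killing vector field of $Sol_3$, and let $\mathcal M\subset Sol_3$ be an $X$-invariant translator in the direction of $V$ with $(0,0,0)\in\mathcal M$. If $ab\neq0$, then we have two possibilities: 1) either $\mathcal M$ is the horizontal plane $z=0$ (hence it is minimal) and $V$ is tangent to it, 2) or $\mathcal M$ is a complete graph $y=F(x,z)$ for some function $F$.
   Context: $Sol_3$ is $\mathbb R^3$ with coordinates $(x,y,z)$, group law $(x_1,y_1,z_1)\star(x_2,y_2,z_2)=(x_1+e^{-z_1}x_2,\;y_1+e^{z_1}y_2,\;z_1+z_2)$ and left-invariant metric $\bar g=e^{2z}dx^2+e^{-2z}dy^2+dz^2$. Its Killing vector fields are the constant-coefficient linear combinations of $F_1=\partial_x$, $F_2=\partial_y$, $F_3=-x\partial_x+y\partial_y+\partial_z$. A surface $\mathcal M$ with unit normal $\nu$ is a translator in the direction of a Killing field $V$ if $H=\bar g(\nu,V)$, where $H$ is the mean curvature, i.e. the trace of the second fundamental form $A(S,T)=\bar g(\bar\nabla_S T,\nu)$ (sum of the principal curvatures). A surface is $X$-invariant if it is invariant under the one-parameter group of isometries generated by $X$; for $X=aF_1+bF_2$ this is $(x,y,z)\mapsto(x+at,y+bt,z)$, $t\in\mathbb R$. Surfaces are connected and inextendible: $\mathcal M$ is generated, under the group action, by a profile curve in $\{x=0\}$ that is a maximal solution of the corresponding ODE, and it contains the origin. *)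

theory Defs
  imports "HOL-Analysis.Analysis"
begin

section \<open>Partial derivatives\<close>

definition partial :: "'n::finite \<Rightarrow> (real^'n \<Rightarrow> 'b::real_normed_vector) \<Rightarrow> real^'n \<Rightarrow> 'b"
  where "partial i f u = vector_derivative (\<lambda>h. f (u + h *\<^sub>R axis i 1)) (at 0)"

text \<open>These two predicates are meant for open sets \<open>U\<close>.\<close>

definition C1_on :: "(real^'n) set \<Rightarrow> (real^'n::finite \<Rightarrow> 'b::real_normed_vector) \<Rightarrow> bool"
  where "C1_on U f \<longleftrightarrow>
    (\<forall>i. (\<forall>u\<in>U. (\<lambda>h. f (u + h *\<^sub>R axis i 1)) differentiable (at 0)) \<and>
         continuous_on U (partial i f))"

definition C2_on :: "(real^'n) set \<Rightarrow> (real^'n::finite \<Rightarrow> 'b::real_normed_vector) \<Rightarrow> bool"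
  where "C2_on U f \<longleftrightarrow> C1_on U f \<and> (\<forall>i. C1_on U (partial i f))"

section \<open>The homogeneous space Sol3\<close>

definition sol_mult :: "real^3 \<Rightarrow> real^3 \<Rightarrow> real^3"  (infixl \<open>\<star>\<close> 70)
  where "p \<star> q = vector [p$1 + exp (- p$3) * q$1, p$2 + exp (p$3) * q$2, p$3 + q$3]"

definition sol_metric :: "real^3 \<Rightarrow> real^3 \<Rightarrow> real^3 \<Rightarrow> real"
  where "sol_metric p v w =
    exp (2 * p$3) * v$1 * w$1 + exp (- 2 * p$3) * v$2 * w$2 + v$3 * w$3"

lemma sol_metric_left_invariant:
  "sol_metric (p \<star> q) (vector [exp (- p$3) * v$1, exp (p$3) * v$2, v$3])
     (vector [exp (- p$3) * w$1, exp (p$3) * w$2, w$3]) = sol_metric q v w"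
proof -
  have e: "exp (2 * p$3 + 2 * q$3) * (exp (- p$3) * exp (- p$3)) = exp (2 * q$3)"
    "exp (- 2 * p$3 + - 2 * q$3) * (exp (p$3) * exp (p$3)) = exp (- 2 * q$3)"
    by (simp_all flip: exp_add)
  show ?thesis
    using arg_cong[OF e(1), of "\<lambda>x. x * v$1 * w$1"] arg_cong[OF e(2), of "\<lambda>x. x * v$2 * w$2"]
    by (auto simp: sol_metric_def sol_mult_def algebra_simps)
qed

definition F1 :: "real^3 \<Rightarrow> real^3" where "F1 p = vector [1, 0, 0]"
definition F2 :: "real^3 \<Rightarrow> real^3" where "F2 p = vector [0, 1, 0]"
definition F3 :: "real^3 \<Rightarrow> real^3" where "F3 p = vector [- p$1, p$2, 1]"

definition killing_field :: "(real^3 \<Rightarrow> real^3) \<Rightarrow> bool"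
  where "killing_field V \<longleftrightarrow>
    (\<exists>c1 c2 c3. \<forall>p. V p = c1 *\<^sub>R F1 p + c2 *\<^sub>R F2 p + c3 *\<^sub>R F3 p)"

text \<open>Levi-Civita connection of the metric, through its Christoffel symbols in the coordinates
  \<open>(x, y, z)\<close>: \<open>christoffel k i j\<close> is the component along the \<open>k\<close>-th coordinate field of the covariant
  derivative of the \<open>j\<close>-th coordinate field in the direction of the \<open>i\<close>-th one.\<close>

definition gram :: "real^3 \<Rightarrow> real^3^3"
  where "gram p = (\<chi> i j. sol_metric p (axis i 1) (axis j 1))"

definition christoffel :: "3 \<Rightarrow> 3 \<Rightarrow> 3 \<Rightarrow> real^3 \<Rightarrow> real"
  where "christoffel k i j p =
    (1/2) * (\<Sum>l\<in>UNIV. matrix_inv (gram p) $ k $ l *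
      (partial i (\<lambda>q. gram q $ j $ l) p + partial j (\<lambda>q. gram q $ i $ l) p
        - partial l (\<lambda>q. gram q $ i $ j) p))"

section \<open>Parametrized surfaces\<close>

definition immersed_surface :: "(real^2) set \<Rightarrow> (real^2 \<Rightarrow> real^3) \<Rightarrow> bool"
  where "immersed_surface U \<Psi> \<longleftrightarrow>
    open U \<and> connected U \<and> U \<noteq> {} \<and> C2_on U \<Psi> \<and>
    (\<forall>u\<in>U. \<forall>c::real^2. (\<Sum>i\<in>UNIV. c $ i *\<^sub>R partial i \<Psi> u) = 0 \<longrightarrow> c = 0)"

definition unit_normal :: "(real^2) set \<Rightarrow> (real^2 \<Rightarrow> real^3) \<Rightarrow> (real^2 \<Rightarrow> real^3) \<Rightarrow> bool"
  where "unit_normal U \<Psi> \<nu> \<longleftrightarrow> continuous_on U \<nu> \<and>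
    (\<forall>u\<in>U. sol_metric (\<Psi> u) (\<nu> u) (\<nu> u) = 1 \<and>
           (\<forall>i. sol_metric (\<Psi> u) (\<nu> u) (partial i \<Psi> u) = 0))"

text \<open>The ambient covariant derivative of the \<open>j\<close>-th coordinate tangent field of \<open>\<Psi>\<close> in the
  direction of the \<open>i\<close>-th one.\<close>

definition cov_deriv :: "(real^2 \<Rightarrow> real^3) \<Rightarrow> 2 \<Rightarrow> 2 \<Rightarrow> real^2 \<Rightarrow> real^3"
  where "cov_deriv \<Psi> i j u = partial i (partial j \<Psi>) u +
    (\<chi> k. \<Sum>l\<in>UNIV. \<Sum>m\<in>UNIV.
        christoffel k l m (\<Psi> u) * partial i \<Psi> u $ l * partial j \<Psi> u $ m)"

definition first_form :: "(real^2 \<Rightarrow> real^3) \<Rightarrow> real^2 \<Rightarrow> real^2^2"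
  where "first_form \<Psi> u = (\<chi> i j. sol_metric (\<Psi> u) (partial i \<Psi> u) (partial j \<Psi> u))"

definition second_form :: "(real^2 \<Rightarrow> real^3) \<Rightarrow> (real^2 \<Rightarrow> real^3) \<Rightarrow> real^2 \<Rightarrow> real^2^2"
  where "second_form \<Psi> \<nu> u = (\<chi> i j. sol_metric (\<Psi> u) (cov_deriv \<Psi> i j u) (\<nu> u))"

text \<open>Trace of the second fundamental form with respect to the induced metric, that is, the sum
  (not the average) of the principal curvatures.\<close>

definition mean_curvature :: "(real^2 \<Rightarrow> real^3) \<Rightarrow> (real^2 \<Rightarrow> real^3) \<Rightarrow> real^2 \<Rightarrow> real"
  where "mean_curvature \<Psi> \<nu> u = trace (matrix_inv (first_form \<Psi> u) ** second_form \<Psi> \<nu> u)"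

definition translator :: "(real^3 \<Rightarrow> real^3) \<Rightarrow> (real^2) set \<Rightarrow> (real^2 \<Rightarrow> real^3) \<Rightarrow> bool"
  where "translator V U \<Psi> \<longleftrightarrow> immersed_surface U \<Psi> \<and>
    (\<exists>\<nu>. unit_normal U \<Psi> \<nu> \<and>
       (\<forall>u\<in>U. mean_curvature \<Psi> \<nu> u = sol_metric (\<Psi> u) (\<nu> u) (V (\<Psi> u))))"

definition minimal_surface :: "(real^2) set \<Rightarrow> (real^2 \<Rightarrow> real^3) \<Rightarrow> bool"
  where "minimal_surface U \<Psi> \<longleftrightarrow> immersed_surface U \<Psi> \<and>
    (\<exists>\<nu>. unit_normal U \<Psi> \<nu> \<and> (\<forall>u\<in>U. mean_curvature \<Psi> \<nu> u = 0))"

definition tangent_along :: "(real^3 \<Rightarrow> real^3) \<Rightarrow> (real^2) set \<Rightarrow> (real^2 \<Rightarrow> real^3) \<Rightarrow> bool"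
  where "tangent_along V U \<Psi> \<longleftrightarrow> (\<forall>u\<in>U. V (\<Psi> u) \<in> span (range (\<lambda>i. partial i \<Psi> u)))"

section \<open>Surfaces invariant under the group generated by a F1 + b F2\<close>

definition flow :: "real \<Rightarrow> real \<Rightarrow> real \<Rightarrow> real^3 \<Rightarrow> real^3"
  where "flow a b t p = vector [p$1 + a * t, p$2 + b * t, p$3]"

lemma flow_eq: "flow a b t p = p + t *\<^sub>R vector [a, b, 0]"
  by (simp add: flow_def vec_eq_iff forall_3)

lemma flow_integral_curve:
  "((\<lambda>t. flow a b t p) has_vector_derivative
      a *\<^sub>R F1 (flow a b t p) + b *\<^sub>R F2 (flow a b t p)) (at t)"
proof -
  have "a *\<^sub>R F1 (flow a b t p) + b *\<^sub>R F2 (flow a b t p) = vector [a, b, 0]"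
    by (simp add: F1_def F2_def vec_eq_iff forall_3)
  then show ?thesis
    unfolding flow_eq by (auto intro!: derivative_eq_intros)
qed

lemma flow_0: "flow a b 0 p = p"
  by (simp add: flow_eq)

text \<open>The surface swept out by the profile curve \<open>\<gamma>\<close>: the first parameter runs along \<open>\<gamma>\<close>, the second
  one is the time of the flow.\<close>

definition orbit_surface :: "real \<Rightarrow> real \<Rightarrow> (real \<Rightarrow> real^3) \<Rightarrow> real^2 \<Rightarrow> real^3"
  where "orbit_surface a b \<gamma> u = flow a b (u$2) (\<gamma> (u$1))"

definition strip :: "real set \<Rightarrow> (real^2) set"
  where "strip I = {u. u$1 \<in> I}"

lemma orbit_surface_invariant:
  "flow a b t ` (orbit_surface a b \<gamma> ` strip I) = orbit_surface a b \<gamma> ` strip I"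
proof -
  have *: "flow a b s (orbit_surface a b \<gamma> u) \<in> orbit_surface a b \<gamma> ` strip I"
    if "u \<in> strip I" for s u
  proof
    show "flow a b s (orbit_surface a b \<gamma> u) = orbit_surface a b \<gamma> (vector [u$1, u$2 + s])"
      by (simp add: orbit_surface_def flow_eq scaleR_add_left)
    show "vector [u$1, u$2 + s] \<in> strip I"
      using that by (simp add: strip_def)
  qed
  have "p \<in> flow a b t ` (orbit_surface a b \<gamma> ` strip I)"
    if "p \<in> orbit_surface a b \<gamma> ` strip I" for p
  proof
    show "p = flow a b t (flow a b (- t) p)"
      by (simp add: flow_eq)
    show "flow a b (- t) p \<in> orbit_surface a b \<gamma> ` strip I"
      using that * by auto
  qed
  with * show ?thesis by blast
qed

text \<open>A profile curve lies in the plane \<open>x = 0\<close> and is parametrized by arc length, so that the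
  translator equation becomes an ordinary differential equation for \<open>\<gamma>\<close>. Fixing the speed is
  what makes maximality of the interval of definition meaningful: with free reparametrization any
  piece of a solution could be defined on the whole line.\<close>

definition profile_solution ::
    "real \<Rightarrow> real \<Rightarrow> (real^3 \<Rightarrow> real^3) \<Rightarrow> real set \<Rightarrow> (real \<Rightarrow> real^3) \<Rightarrow> bool"
  where "profile_solution a b V I \<gamma> \<longleftrightarrow>
    open I \<and> is_interval I \<and> I \<noteq> {} \<and>
    (\<forall>s\<in>I. \<gamma> s $ 1 = 0 \<and>
       sol_metric (\<gamma> s) (vector_derivative \<gamma> (at s)) (vector_derivative \<gamma> (at s)) = 1) \<and>
    translator V (strip I) (orbit_surface a b \<gamma>)"

definition maximal_profile ::
    "real \<Rightarrow> real \<Rightarrow> (real^3 \<Rightarrow> real^3) \<Rightarrow> real set \<Rightarrow> (real \<Rightarrow> real^3) \<Rightarrow> bool"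
  where "maximal_profile a b V I \<gamma> \<longleftrightarrow> profile_solution a b V I \<gamma> \<and>
    (\<forall>J \<delta>. profile_solution a b V J \<delta> \<and> I \<subseteq> J \<and> (\<forall>s\<in>I. \<delta> s = \<gamma> s) \<longrightarrow> J = I)"

section \<open>Completeness and graphs\<close>

definition speed :: "(real \<Rightarrow> real^3) \<Rightarrow> real \<Rightarrow> real"
  where "speed c s =
    sqrt (sol_metric (c s) (vector_derivative c (at s)) (vector_derivative c (at s)))"

text \<open>The library's piecewise \<open>C1\<close> paths may have unbounded speed near a break point, and the integral
  of a non-integrable function is 0; hence the explicit integrability requirement.\<close>

definition connecting_paths :: "(real^3) set \<Rightarrow> real^3 \<Rightarrow> real^3 \<Rightarrow> (real \<Rightarrow> real^3) set"
  where "connecting_paths M p q =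
    {c. valid_path c \<and> speed c integrable_on {0..1} \<and> path_image c \<subseteq> M \<and>
        pathstart c = p \<and> pathfinish c = q}"

text \<open>Riemannian distance of the metric induced on an embedded surface \<open>M\<close>; it is infinite if no
  path in \<open>M\<close> joins the two points.\<close>

definition induced_dist :: "(real^3) set \<Rightarrow> real^3 \<Rightarrow> real^3 \<Rightarrow> ereal"
  where "induced_dist M p q =
    (INF c \<in> connecting_paths M p q. ereal (integral {0..1} (speed c)))"

definition complete_surface :: "(real^3) set \<Rightarrow> bool"
  where "complete_surface M \<longleftrightarrow>
    (\<forall>\<sigma>::nat \<Rightarrow> real^3.
       (\<forall>n. \<sigma> n \<in> M) \<and>
       (\<forall>e>0. \<exists>N. \<forall>m\<ge>N. \<forall>n\<ge>N. induced_dist M (\<sigma> m) (\<sigma> n) < ereal e) \<longrightarrow>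
       (\<exists>p\<in>M. (\<lambda>n. induced_dist M (\<sigma> n) p) \<longlonglongrightarrow> 0))"

text \<open>\<open>M\<close> is a graph \<open>y = F (x, z)\<close>. The domain need not be the whole \<open>(x, z)\<close>-plane: it may be a strip
  between two planes of constant \<open>z\<close> to which the graph is asymptotic.\<close>

definition graph_over_xz :: "(real^3) set \<Rightarrow> bool"
  where "graph_over_xz M \<longleftrightarrow>
    (\<exists>(\<Omega>::(real^2) set) F. open \<Omega> \<and> C2_on \<Omega> F \<and> M = (\<lambda>u. vector [u$1, F u, u$2]) ` \<Omega>)"

end

theory Submission
  imports Defs
begin

text \<open>Write the velocity of the profile as \<open>(v, u)\<close> in the frame \<open>e\<^sup>z \<partial>\<^sub>y, \<partial>\<^sub>z\<close>. In the translator equation the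
  flow time \<open>t\<close> occurs only with the coefficient \<open>2 a b c3 u\<close>, which forces \<open>c3 = 0\<close> and leaves an
  autonomous system \<open>z' = u, u' = v w, v' = - u w\<close> with \<open>w\<close> a smooth function of \<open>(z, u, v)\<close>. Since
  \<open>u\<^sup>2 + v\<^sup>2 = 1\<close>, solutions exist for all time, so a maximal profile is defined on the whole line. The states with
  \<open>u = 0\<close> are stationary, so \<open>u\<close> vanishes identically, which gives the plane \<open>z = 0\<close>, or nowhere. In the
  latter case \<open>z\<close> is strictly monotone along the profile and the surface is a graph. On a part of it
  of bounded height the length of a path bounds the variations of \<open>x\<close> and of the profile
  parameter, so Cauchy sequences converge.\<close>

section \<open>Ordinary differential equations\<close>

text \<open>Moving by flow time \<open>t\<close> adds \<open>t * c3\<close> times (-a, b, 0) to V,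
  while the flow acts by isometries preserving the surface and its mean curvature. So for
  \<open>c3 \<noteq> 0\<close> both (a, b, 0) and (-a, b, 0) would be tangent, and as
  \<open>a * b \<noteq> 0\<close> the surface would be horizontal; such a surface is minimal, but V
  would still have the vertical component \<open>c3\<close> along its normal. The delicate point of
  completeness is that \<open>\<bar>u\<bar>\<close> has no positive lower bound: the graph may be
  asymptotic to a horizontal plane, where a tiny change of height is a huge change of the profile
  parameter. The parameter must therefore be controlled by the vertical and the horizontal velocity
  together. That the profile lives on the whole line serves twice: the limit of a convergent
  sequence of parameters is again a parameter, and a stationary profile fills a whole straight line,
  so that its surface is all of the plane.\<close>

definition prim :: "(real \<Rightarrow> 'a::banach) \<Rightarrow> real \<Rightarrow> 'a"
  where "prim g s = integral {0..s} g - integral {s..0} g"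

lemma prim_0 [simp]: "prim g 0 = 0"
  by (simp add: prim_def)

text \<open>An integral over an empty interval is 0, so \<open>prim\<close> is the signed integral
  from 0. Moving the base point to \<open>- N\<close>, left of both 0 and \<open>s\<close>, covers
  both signs by one application of the fundamental theorem.\<close>

lemma has_vector_derivative_prim:
  fixes g :: "real \<Rightarrow> 'a::banach"
  assumes g: "continuous_on UNIV g"
  shows "(prim g has_vector_derivative g s) (at s)"
proof -
  define N where "N = \<bar>s\<bar> + 1"
  have gc: "continuous_on T g" for T
    using g continuous_on_subset by blast
  have int: "g integrable_on {p..q}" for p q
    using gc by (rule integrable_continuous_real)
  have eq: "integral {-N..r} g - integral {-N..0} g = prim g r" if "r \<in> {-N<..<N}" for r
  proof (cases "0 \<le> r")
    case True
    then show ?thesis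
      using Henstock_Kurzweil_Integration.integral_combine[of "-N" 0 r g] that int
      by (cases "r = 0") (auto simp: prim_def N_def algebra_simps)
  next
    case False
    then show ?thesis
      using Henstock_Kurzweil_Integration.integral_combine[of "-N" r 0 g] that int
      by (auto simp: prim_def N_def algebra_simps)
  qed
  have s: "s \<in> {-N<..<N}"
    by (auto simp: N_def)
  have "((\<lambda>r. integral {-N..r} g) has_vector_derivative g s) (at s within {-N..N})"
    using s by (intro integral_has_vector_derivative gc) auto
  then have "((\<lambda>r. integral {-N..r} g) has_vector_derivative g s) (at s within {-N<..<N})"
    by (rule has_vector_derivative_within_subset) auto
  then have "((\<lambda>r. integral {-N..r} g) has_vector_derivative g s) (at s)"
    using s by (simp add: at_within_open[OF s])
  then have "((\<lambda>r. integral {-N..r} g - integral {-N..0} g) has_vector_derivative g s) (at s)"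
    by (auto intro!: derivative_eq_intros)
  then show ?thesis
    by (rule has_vector_derivative_transform_within_open[where S = "{-N<..<N}"]) (use s eq in auto)
qed

text \<open>Integration reproduces exponential growth and gains the factor \<open>1 / K\<close>;
  this gain is what makes the integral operator of the next lemma a contraction.\<close>

lemma norm_prim_le:
  fixes g :: "real \<Rightarrow> 'a::banach"
  assumes g: "continuous_on UNIV g" and K: "0 < K"
    and le: "\<And>r. norm (g r) \<le> C * exp (K * \<bar>r\<bar>)"
  shows "norm (prim g s) \<le> C / K * exp (K * \<bar>s\<bar>)"
proof -
  have C: "0 \<le> C"
    using order_trans[OF norm_ge_zero le[of 0]] by simp
  have int: "g integrable_on {p..q}" for p q
    using g by (intro integrable_continuous_real) (rule continuous_on_subset, auto)
  show ?thesis
  proof (cases "0 \<le> s")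
    case True
    have "((\<lambda>r. C * exp (K * r)) has_integral (C / K * exp (K * s) - C / K * exp (K * 0))) {0..s}"
      using True K by (intro fundamental_theorem_of_calculus)
        (auto intro!: derivative_eq_intros simp: has_real_derivative_iff_has_vector_derivative[symmetric])
    note hi = this
    have "norm (g r) \<le> C * exp (K * r)" if "r \<in> {0..s}" for r
      using le[of r] that by simp
    then have "norm (integral {0..s} g) \<le> integral {0..s} (\<lambda>r. C * exp (K * r))"
      using int has_integral_integrable[OF hi] by (intro integral_norm_bound_integral) auto
    also note integral_unique[OF hi]
    finally have "norm (integral {0..s} g) \<le> C / K * exp (K * s) - C / K * exp (K * 0)" .
    moreover have "0 \<le> C / K"
      using C K by simp
    ultimately show ?thesis
      using True by (cases "s = 0") (simp_all add: prim_def)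
  next
    case False
    have "((\<lambda>r. C * exp (K * - r)) has_integral
        (- C / K * exp (K * - 0) - (- C / K * exp (K * - s)))) {s..0}"
      using False K by (intro fundamental_theorem_of_calculus)
        (auto intro!: derivative_eq_intros simp: has_real_derivative_iff_has_vector_derivative[symmetric])
    note hi = this
    have "norm (g r) \<le> C * exp (K * - r)" if "r \<in> {s..0}" for r
      using le[of r] that by simp
    then have "norm (integral {s..0} g) \<le> integral {s..0} (\<lambda>r. C * exp (K * - r))"
      using int has_integral_integrable[OF hi] by (intro integral_norm_bound_integral) auto
    also note integral_unique[OF hi]
    finally have "norm (integral {s..0} g) \<le> - C / K * exp (K * - 0) - (- C / K * exp (K * - s))" .
    moreover have "0 \<le> C / K"
      using C K by simp
    ultimately show ?thesis
      using False by (simp add: prim_def)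
  qed
qed

text \<open>Picard iteration in a norm weighted by \<open>exp (- K * \<bar>s\<bar>)\<close>: the
  weight makes the integral operator contract on the whole line at once, without gluing short-time
  solutions.\<close>

lemma global_lipschitz_ode_exists:
  fixes G :: "'a::banach \<Rightarrow> 'a"
  assumes G: "L-lipschitz_on UNIV G"
  obtains x where "x 0 = x0" "\<And>s. (x has_vector_derivative G (x s)) (at s)"
proof -
  \<comment> \<open>The term \<open>2 * L\<close> brings the contraction factor \<open>L / K\<close>
    below 1/2; the summand 1 keeps \<open>K\<close> positive for \<open>L = 0\<close>.\<close>
  define K where "K = 2 * L + 1"
  have L: "0 \<le> L" and K: "0 < K"
    using lipschitz_on_nonneg[OF G] by (auto simp: K_def)
  have Gc: "continuous_on UNIV G"
    using G by (rule lipschitz_on_continuous_on)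
  \<comment> \<open>The unknown \<open>w\<close> is the rescaled deviation from \<open>x0\<close>.
    It ranges over the Banach space of bounded continuous functions, although the curve
    \<open>X w\<close> itself may grow exponentially.\<close>
  define X :: "(real \<Rightarrow>\<^sub>C 'a) \<Rightarrow> real \<Rightarrow> 'a" where "X w s = x0 + exp (K * \<bar>s\<bar>) *\<^sub>R w s" for w s
  have GXc: "continuous_on UNIV (\<lambda>s. G (X w s))" for w
    unfolding X_def by (intro continuous_on_compose2[OF Gc] continuous_intros) auto
  have Gdist: "norm (G p - G q) \<le> L * norm (p - q)" for p q
    using lipschitz_on_normD[OF G] by simp
  have primc: "continuous_on UNIV (prim (\<lambda>s. G (X w s)))" for w
    using has_vector_derivative_prim[OF GXc]
    by (meson continuous_at_imp_continuous_on has_vector_derivative_continuous)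
  have bcont: "(\<lambda>s. exp (- K * \<bar>s\<bar>) *\<^sub>R prim (\<lambda>s. G (X w s)) s) \<in> bcontfun" for w
  proof (rule bcontfun_normI)
    show "continuous_on UNIV (\<lambda>s. exp (- K * \<bar>s\<bar>) *\<^sub>R prim (\<lambda>s. G (X w s)) s)"
      by (intro continuous_intros primc)
    define C where "C = norm (G x0) + L * norm w"
    have "norm (G (X w r)) \<le> C * exp (K * \<bar>r\<bar>)" for r
    proof -
      have "norm (G (X w r)) \<le> norm (G x0) + norm (G (X w r) - G x0)"
        by (metis add.commute diff_add_cancel norm_triangle_ineq)
      also have "norm (G (X w r) - G x0) \<le> L * (exp (K * \<bar>r\<bar>) * norm (w r))"
        using Gdist[of "X w r" x0] by (simp add: X_def)
      also have "\<dots> \<le> L * (exp (K * \<bar>r\<bar>) * norm w)"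
        using L norm_bounded by (intro mult_left_mono) auto
      also have "norm (G x0) \<le> norm (G x0) * exp (K * \<bar>r\<bar>)"
        using K by (simp add: mult_le_cancel_left1)
      finally show ?thesis
        by (simp add: C_def algebra_simps)
    qed
    from norm_prim_le[OF GXc K this]
    have *: "norm (prim (\<lambda>s. G (X w s)) s) \<le> C / K * exp (K * \<bar>s\<bar>)" for s .
    show "norm (exp (- K * \<bar>s\<bar>) *\<^sub>R prim (\<lambda>s. G (X w s)) s) \<le> C / K" for s
      using mult_left_mono[OF *[of s], of "exp (- K * \<bar>s\<bar>)"]
      by (simp add: mult.left_commute flip: exp_add)
  qed
  define T where "T w = Bcontfun (\<lambda>s. exp (- K * \<bar>s\<bar>) *\<^sub>R prim (\<lambda>s. G (X w s)) s)" for w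
  have T: "T w s = exp (- K * \<bar>s\<bar>) *\<^sub>R prim (\<lambda>s. G (X w s)) s" for w s
    unfolding T_def by (simp only: Bcontfun_inverse[OF bcont])
  have contr: "dist (T w) (T w') \<le> 1/2 * dist w w'" for w w'
  proof (rule dist_bound)
    fix s
    have diff: "prim (\<lambda>s. G (X w s)) s - prim (\<lambda>s. G (X w' s)) s =
        prim (\<lambda>s. G (X w s) - G (X w' s)) s"
    proof -
      have "(\<lambda>s. G (X w s)) integrable_on {p..q}" for w p q
        using GXc[of w] by (intro integrable_continuous_real) (rule continuous_on_subset, auto)
      then show ?thesis
        by (simp add: prim_def Henstock_Kurzweil_Integration.integral_diff)
    qed
    have "norm (G (X w r) - G (X w' r)) \<le> (L * dist w w') * exp (K * \<bar>r\<bar>)" for r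
    proof -
      have "norm (G (X w r) - G (X w' r)) \<le> L * norm (exp (K * \<bar>r\<bar>) *\<^sub>R (w r - w' r))"
        using Gdist[of "X w r" "X w' r"] by (simp add: X_def scaleR_diff_right)
      also have "\<dots> = L * (exp (K * \<bar>r\<bar>) * dist (w r) (w' r))"
        by (simp add: dist_norm)
      also have "\<dots> \<le> L * (exp (K * \<bar>r\<bar>) * dist w w')"
        using L dist_bounded by (intro mult_left_mono) auto
      finally show ?thesis
        by (simp add: algebra_simps)
    qed
    from norm_prim_le[OF continuous_on_diff[OF GXc GXc] K this]
    have *: "norm (prim (\<lambda>s. G (X w s) - G (X w' s)) s) \<le> L * dist w w' / K * exp (K * \<bar>s\<bar>)" .
    have "dist (T w s) (T w' s) \<le> L * dist w w' / K"
      using mult_left_mono[OF *, of "exp (- K * \<bar>s\<bar>)"]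
      by (simp add: T dist_norm mult.left_commute diff flip: exp_add scaleR_diff_right)
    also have "\<dots> \<le> 1/2 * dist w w'"
    proof -
      have "L / K \<le> 1/2"
        using L K by (simp add: K_def field_simps)
      from mult_right_mono[OF this, of "dist w w'"] show ?thesis
        by simp
    qed
    finally show "dist (T w s) (T w' s) \<le> 1/2 * dist w w'" .
  qed
  obtain w where w: "T w = w"
  proof -
    have "\<exists>!w. T w = w"
      using contr by (intro banach_fix_type[where c = "1/2"]) simp_all
    with that show thesis
      by blast
  qed
  have X: "X w s = x0 + prim (\<lambda>s. G (X w s)) s" for s
  proof -
    have "X w s = x0 + exp (K * \<bar>s\<bar>) *\<^sub>R T w s"
      by (simp add: X_def w)
    then show ?thesis
      by (simp add: T flip: exp_add)
  qed
  define Y where "Y s = x0 + prim (\<lambda>s. G (X w s)) s" for s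
  have XY: "X w = Y"
    unfolding Y_def by (rule ext) (rule X)
  have "(Y has_vector_derivative G (X w s)) (at s)" for s
    unfolding Y_def by (auto intro!: derivative_eq_intros has_vector_derivative_prim GXc)
  then have "(X w has_vector_derivative G (X w s)) (at s)" for s
    by (simp add: XY)
  moreover have "X w 0 = x0"
    using X[of 0] by simp
  ultimately show ?thesis
    using that by blast
qed

text \<open>To the right of \<open>r\<close> the product of \<open>D\<close> with
  \<open>exp (- C * s)\<close> cannot grow; to the left the same holds backwards with
  \<open>exp (C * s)\<close>. Hence a zero of the nonnegative \<open>D\<close> spreads both
  ways.\<close>

lemma gronwall_zero:
  fixes D :: "real \<Rightarrow> real"
  assumes D: "\<And>s. s \<in> {p..q} \<Longrightarrow> (D has_real_derivative D' s) (at s)"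
    and le: "\<And>s. s \<in> {p..q} \<Longrightarrow> \<bar>D' s\<bar> \<le> C * D s"
    and nonneg: "\<And>s. 0 \<le> D s"
    and r: "r \<in> {p..q}" "D r = 0" and s: "s \<in> {p..q}"
  shows "D s = 0"
proof (cases "r \<le> s")
  case True
  have "D s * exp (- C * s) \<le> D r * exp (- C * r)"
  proof (rule DERIV_nonpos_imp_nonincreasing[OF True])
    fix t assume "r \<le> t" "t \<le> s"
    then have t: "t \<in> {p..q}"
      using r s by auto
    have "((\<lambda>t. D t * exp (- C * t)) has_real_derivative (D' t - C * D t) * exp (- C * t)) (at t)"
      by (auto intro!: derivative_eq_intros D[OF t] simp: algebra_simps)
    moreover have "(D' t - C * D t) * exp (- C * t) \<le> 0"
      using le[OF t] by (intro mult_nonpos_nonneg) auto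
    ultimately show "\<exists>y. ((\<lambda>t. D t * exp (- C * t)) has_real_derivative y) (at t) \<and> y \<le> 0"
      by blast
  qed
  then have "D s \<le> 0"
    using r by (simp add: mult_le_0_iff)
  with nonneg[of s] show ?thesis by simp
next
  case False
  then have sr: "s \<le> r" by simp
  have "D s * exp (C * s) \<le> D r * exp (C * r)"
  proof (rule DERIV_nonneg_imp_nondecreasing[OF sr])
    fix t assume "s \<le> t" "t \<le> r"
    then have t: "t \<in> {p..q}"
      using r s by auto
    have "((\<lambda>t. D t * exp (C * t)) has_real_derivative (D' t + C * D t) * exp (C * t)) (at t)"
      by (auto intro!: derivative_eq_intros D[OF t] simp: algebra_simps)
    moreover have "0 \<le> (D' t + C * D t) * exp (C * t)"
      using le[OF t] by (intro mult_nonneg_nonneg) auto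
    ultimately show "\<exists>y. ((\<lambda>t. D t * exp (C * t)) has_real_derivative y) (at t) \<and> 0 \<le> y"
      by blast
  qed
  then have "D s \<le> 0"
    using r by (simp add: mult_le_0_iff)
  with nonneg[of s] show ?thesis by simp
qed

text \<open>On the compact interval between \<open>r\<close> and \<open>s\<close> both curves stay
  in one ball, so a Lipschitz constant per ball suffices. The squared distance is differentiable
  even where the curves meet.\<close>

lemma ode_unique:
  fixes H :: "'a::real_inner \<Rightarrow> 'a"
  assumes lip: "\<And>R. \<exists>L. L-lipschitz_on (cball 0 R) H"
    and J: "is_interval J"
    and x: "\<And>s. s \<in> J \<Longrightarrow> (x has_vector_derivative H (x s)) (at s)"
    and w: "\<And>s. s \<in> J \<Longrightarrow> (w has_vector_derivative H (w s)) (at s)"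
    and r: "r \<in> J" "x r = w r" and s: "s \<in> J"
  shows "x s = w s"
proof -
  define p q where "p = min r s" and "q = max r s"
  have sub: "{p..q} \<subseteq> J"
  proof
    fix t assume t: "t \<in> {p..q}"
    have "p \<in> J" "q \<in> J"
      using r(1) s by (simp_all add: p_def q_def min_def max_def)
    with J t show "t \<in> J"
      by (simp add: mem_is_interval_1_I[OF J, of p q])
  qed
  have cont: "continuous_on {p..q} x" "continuous_on {p..q} w"
    using has_vector_derivative_continuous[OF x] has_vector_derivative_continuous[OF w] sub
    by (simp_all add: continuous_at_imp_continuous_on subset_eq)
  then have "bounded (x ` {p..q} \<union> w ` {p..q})"
    by (intro bounded_Un[THEN iffD2] conjI compact_imp_bounded compact_continuous_image) auto
  then obtain R where R: "x ` {p..q} \<union> w ` {p..q} \<subseteq> cball 0 R"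
    by (auto simp: bounded_iff subset_eq)
  obtain L where L: "L-lipschitz_on (cball 0 R) H"
    using lip by blast
  define D where "D t = (x t - w t) \<bullet> (x t - w t)" for t
  have "D s = 0"
  proof (rule gronwall_zero[where D = D and s = s and p = p and q = q and C = "2 * L" and r = r
        and D' = "\<lambda>t. 2 * ((H (x t) - H (w t)) \<bullet> (x t - w t))"])
    fix t assume t: "t \<in> {p..q}"
    then have "t \<in> J" using sub by auto
    show "(D has_real_derivative 2 * ((H (x t) - H (w t)) \<bullet> (x t - w t))) (at t)"
    proof -
      have "((\<lambda>t. x t - w t) has_vector_derivative H (x t) - H (w t)) (at t)"
        by (intro has_vector_derivative_diff x w \<open>t \<in> J\<close>)
      then have d: "((\<lambda>t. x t - w t) has_derivative (\<lambda>h. h *\<^sub>R (H (x t) - H (w t)))) (at t)"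
        by (simp only: has_vector_derivative_def)
      from has_derivative_inner[OF d d] show ?thesis
        unfolding D_def has_field_derivative_def
        by (rule has_derivative_eq_rhs) (simp add: fun_eq_iff inner_commute)
    qed
    have "\<bar>(H (x t) - H (w t)) \<bullet> (x t - w t)\<bar> \<le> norm (H (x t) - H (w t)) * norm (x t - w t)"
      by (rule Cauchy_Schwarz_ineq2)
    also have "\<dots> \<le> (L * norm (x t - w t)) * norm (x t - w t)"
    proof (intro mult_right_mono lipschitz_on_normD[OF L])
      show "x t \<in> cball 0 R" "w t \<in> cball 0 R"
        using R t by blast+
    qed simp
    also have "\<dots> = L * D t"
      by (simp add: D_def dot_square_norm power2_eq_square)
    finally show "\<bar>2 * ((H (x t) - H (w t)) \<bullet> (x t - w t))\<bar> \<le> 2 * L * D t"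
      by simp
  qed (use r in \<open>simp_all add: D_def p_def q_def\<close>)
  then show ?thesis
    by (simp add: D_def)
qed

section \<open>Derivatives and connection in coordinates\<close>

lemma vector_3_axis: "vector [p, q, r] = p *\<^sub>R axis 1 1 + q *\<^sub>R axis 2 1 + (r *\<^sub>R axis 3 1 :: real^3)"
  by (simp add: vec_eq_iff forall_3 axis_def)

lemma has_vector_derivative_vector_3:
  assumes "(f has_real_derivative f') (at s)" "(g has_real_derivative g') (at s)"
    "(h has_real_derivative h') (at s)"
  shows "((\<lambda>s. vector [f s, g s, h s] :: real^3) has_vector_derivative vector [f', g', h']) (at s)"
  using assms unfolding vector_3_axis by (auto intro!: derivative_eq_intros)

text \<open>\<open>matrix_inv\<close> is a choice; \<open>B\<close> witnesses that the chosen matrix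
  is a two-sided inverse, and such an inverse is unique.\<close>

lemma matrix_inv_eqI:
  fixes A B :: "real^'n^'n"
  assumes "A ** B = mat 1" "B ** A = mat 1"
  shows "matrix_inv A = B"
proof -
  have "A ** matrix_inv A = mat 1 \<and> matrix_inv A ** A = mat 1"
    using assms unfolding matrix_inv_def
    by (intro someI[where P = "\<lambda>C. A ** C = mat 1 \<and> C ** A = mat 1" and x = B] conjI)
  then have "matrix_inv A ** (A ** B) = B"
    by (simp add: matrix_mul_assoc)
  then show ?thesis
    by (simp add: assms(1))
qed

lemma trace_matrix_inv_2:
  fixes g h :: "real^2^2"
  assumes "g $ 1 $ 1 * g $ 2 $ 2 - g $ 1 $ 2 * g $ 2 $ 1 \<noteq> 0"
  shows "trace (matrix_inv g ** h) =
    (g $ 2 $ 2 * h $ 1 $ 1 - g $ 1 $ 2 * h $ 2 $ 1 - g $ 2 $ 1 * h $ 1 $ 2 + g $ 1 $ 1 * h $ 2 $ 2) /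
    (g $ 1 $ 1 * g $ 2 $ 2 - g $ 1 $ 2 * g $ 2 $ 1)"
proof -
  define d where "d = g $ 1 $ 1 * g $ 2 $ 2 - g $ 1 $ 2 * g $ 2 $ 1"
  \<comment> \<open>The adjugate of \<open>g\<close> divided by the determinant.\<close>
  define B :: "real^2^2" where "B = (\<chi> i j. (if i = 1 then (if j = 1 then g $ 2 $ 2 else - g $ 1 $ 2)
    else (if j = 1 then - g $ 2 $ 1 else g $ 1 $ 1)) / d)"
  have d: "d \<noteq> 0"
    using assms by (simp add: d_def)
  have "matrix_inv g = B"
    by (rule matrix_inv_eqI)
      (use d in \<open>simp_all add: B_def vec_eq_iff forall_2 matrix_matrix_mult_def sum_2 mat_def
        field_simps\<close>, simp_all add: d_def algebra_simps)
  then show ?thesis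
    using d by (simp add: B_def trace_def matrix_matrix_mult_def sum_2 flip: d_def)
      (simp add: field_simps)
qed

lemma gram_nth: "gram p $ i $ j =
    (if i = j then if i = 1 then exp (2 * p$3) else if i = 2 then exp (- 2 * p$3) else 1 else 0)"
proof -
  have "\<forall>i j. gram p $ i $ j =
    (if i = j then if i = 1 then exp (2 * p$3) else if i = 2 then exp (- 2 * p$3) else 1 else 0)"
    unfolding forall_3 by (simp add: gram_def sol_metric_def axis_def)
  then show ?thesis by blast
qed

lemma matrix_inv_gram: "matrix_inv (gram p) $ i $ j =
    (if i = j then if i = 1 then exp (- 2 * p$3) else if i = 2 then exp (2 * p$3) else 1 else 0)"
proof -
  define B :: "real^3^3" where "B = (\<chi> i j. if i = j then if i = 1 then exp (- 2 * p$3)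
    else if i = 2 then exp (2 * p$3) else 1 else 0)"
  have "matrix_inv (gram p) = B"
    by (rule matrix_inv_eqI)
      (simp_all add: B_def gram_nth vec_eq_iff forall_3 matrix_matrix_mult_def sum_3 mat_def flip: exp_add)
  then show ?thesis
    by (simp add: B_def)
qed

lemma partial_gram: "partial l (\<lambda>q. gram q $ i $ j) p =
    (if l = 3 \<and> i = j then if i = 1 then 2 * exp (2 * p$3) else if i = 2 then - 2 * exp (- 2 * p$3) else 0
     else 0)"
proof -
  have "((\<lambda>h. gram (p + h *\<^sub>R axis l 1) $ i $ j) has_vector_derivative
    (if l = 3 \<and> i = j then if i = 1 then 2 * exp (2 * p$3) else if i = 2 then - 2 * exp (- 2 * p$3) else 0
     else 0)) (at 0)"
  proof (cases "l = 3")
    case True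
    then show ?thesis
      unfolding has_real_derivative_iff_has_vector_derivative[symmetric]
      by (auto simp: gram_nth axis_def intro!: derivative_eq_intros)
  next
    case False
    then have *: "(p + h *\<^sub>R axis l 1) $ 3 = p $ 3" for h
      by (simp add: axis_def)
    from False show ?thesis
      unfolding gram_nth * by simp
  qed
  then show ?thesis
    unfolding partial_def by (rule vector_derivative_at)
qed

text \<open>With upper index first, the nonzero symbols are 1 for (1;13) and (1;31), -1 for (2;23)
  and (2;32), \<open>- exp (2 * z)\<close> for (3;11) and \<open>exp (- 2 * z)\<close> for
  (3;22).\<close>

lemma christoffel_sum:
  "(\<chi> k. \<Sum>l\<in>UNIV. \<Sum>m\<in>UNIV. christoffel k l m p * v $ l * w $ m) =
    vector [v$1 * w$3 + v$3 * w$1, - (v$2 * w$3 + v$3 * w$2),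
      exp (- 2 * p$3) * v$2 * w$2 - exp (2 * p$3) * v$1 * w$1]"
proof -
  have e: "exp (p $ 3 * 2) * exp (- (p $ 3 * 2)) = 1" "exp (2 * p $ 3) * exp (- (2 * p $ 3)) = 1"
    by (simp_all flip: exp_add)
  show ?thesis
    by (simp add: vec_eq_iff forall_3 sum_3 christoffel_def matrix_inv_gram partial_gram e algebra_simps)
qed

lemma cov_deriv_eq:
  "cov_deriv \<Psi> i j p = partial i (partial j \<Psi>) p +
    (let v = partial i \<Psi> p; w = partial j \<Psi> p in
      vector [v$1 * w$3 + v$3 * w$1, - (v$2 * w$3 + v$3 * w$2),
        exp (- 2 * \<Psi> p $ 3) * v$2 * w$2 - exp (2 * \<Psi> p $ 3) * v$1 * w$1])"
  unfolding cov_deriv_def christoffel_sum Let_def ..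

section \<open>Partial derivatives of swept surfaces as ordinary derivatives of the profile\<close>

lemma has_vector_derivative_shift_0:
  "((\<lambda>h. f (x + h) + c) has_vector_derivative d) (at 0) \<longleftrightarrow> (f has_vector_derivative d) (at (x::real))"
proof
  assume "((\<lambda>h. f (x + h) + c) has_vector_derivative d) (at 0)"
  from has_vector_derivative_diff[OF this has_vector_derivative_const[of c]]
  have "((\<lambda>h. f (x + h)) has_vector_derivative d) (at (x - x))" by simp
  then have "(((\<lambda>h. f (x + h)) \<circ> (\<lambda>r. r - x)) has_vector_derivative 1 *\<^sub>R d) (at x)"
    by (intro vector_diff_chain_at) (auto intro!: derivative_eq_intros)
  then show "(f has_vector_derivative d) (at x)"
    by (simp add: o_def)
next
  assume "(f has_vector_derivative d) (at x)"
  then have "(f has_vector_derivative d) (at (x + 0))" by simp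
  then have "((f \<circ> (\<lambda>h. x + h)) has_vector_derivative 1 *\<^sub>R d) (at 0)"
    by (intro vector_diff_chain_at) (auto intro!: derivative_eq_intros)
  then show "((\<lambda>h. f (x + h) + c) has_vector_derivative d) (at 0)"
    by (auto simp: o_def intro!: derivative_eq_intros)
qed

lemma differentiable_iff_has_vector_derivative:
  "f differentiable (at x) \<longleftrightarrow> (\<exists>d. (f has_vector_derivative d) (at x))"
  using differentiableI_vector vector_derivative_works by blast

text \<open>No differentiability is assumed: \<open>vector_derivative\<close> is a choice from a
  predicate, and the predicates on both sides are equivalent. As an equation between functions it
  can be iterated for second derivatives.\<close>

lemma partial_profile:
  fixes f :: "real \<Rightarrow> 'a::real_normed_vector"
  shows "partial 1 (\<lambda>p::real^2. f (p$1)) = (\<lambda>p. vector_derivative f (at (p$1)))"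
    and "partial 2 (\<lambda>p::real^2. f (p$1)) = (\<lambda>p. 0)"
  using has_vector_derivative_shift_0[of f _ 0]
  by (simp_all add: fun_eq_iff partial_def axis_def vector_derivative_def[of "\<lambda>h. f (_ + h)"]
      vector_derivative_def[of f])

lemma ball_strip: "(\<forall>p\<in>strip J. P (p $ 1)) \<longleftrightarrow> (\<forall>s\<in>J. P s)"
proof -
  have "axis 1 s \<in> strip J" "axis 1 s $ (1::2) = s" if "s \<in> J" for s
    using that by (simp_all add: strip_def axis_def)
  then have "P s" if "\<forall>p\<in>strip J. P (p $ 1)" "s \<in> J" for s
    using that by metis
  then show ?thesis
    by (auto simp: strip_def)
qed

lemma C1_on_profile:
  fixes f :: "real \<Rightarrow> 'a::real_normed_vector"
  shows "C1_on (strip J) (\<lambda>p::real^2. f (p$1)) \<longleftrightarrow>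
    (\<forall>s\<in>J. f differentiable (at s)) \<and> continuous_on J (\<lambda>s. vector_derivative f (at s))"
proof -
  have strip: "strip J = {p. p $ 1 \<in> J}" by (simp add: strip_def)
  have "continuous_on J (\<lambda>s. vector_derivative f (at s))"
    if "continuous_on (strip J) (\<lambda>p. vector_derivative f (at (p$1)))"
  proof -
    have "continuous_on J (\<lambda>s. s *\<^sub>R axis 1 1 :: real^2)"
      by (intro continuous_intros)
    then have "continuous_on J (\<lambda>s. vector_derivative f (at ((s *\<^sub>R axis 1 1 :: real^2) $ 1)))"
      by (rule continuous_on_compose2[OF that]) (auto simp: strip_def axis_def)
    then show ?thesis by (simp add: axis_def)
  qed
  moreover have "continuous_on (strip J) (\<lambda>p. vector_derivative f (at (p$1)))"
    if "continuous_on J (\<lambda>s. vector_derivative f (at s))"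
    by (rule continuous_on_compose2[OF that]) (auto simp: strip_def intro!: continuous_intros)
  moreover have "(\<lambda>h. f ((p + h *\<^sub>R axis 1 1) $ 1)) differentiable at 0 \<longleftrightarrow> f differentiable (at (p $ 1))"
    for p :: "real^2"
    using has_vector_derivative_shift_0[of f _ 0]
    by (simp add: differentiable_iff_has_vector_derivative axis_def)
  moreover have "(\<forall>p\<in>strip J. f differentiable (at (p $ 1))) \<longleftrightarrow> (\<forall>s\<in>J. f differentiable (at s))"
    by (rule ball_strip)
  moreover have "(\<lambda>h. f ((p + h *\<^sub>R axis 2 1) $ 1)) differentiable at 0" for p :: "real^2"
    by (simp add: axis_def)
  ultimately show ?thesis
    unfolding C1_on_def forall_2 partial_profile by auto
qed

lemma partial_orbit_surface:
  shows "partial 1 (orbit_surface a b \<gamma>) = (\<lambda>p. vector_derivative \<gamma> (at (p$1)))"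
    and "partial 2 (orbit_surface a b \<gamma>) = (\<lambda>p. vector [a, b, 0])"
proof -
  show "partial 1 (orbit_surface a b \<gamma>) = (\<lambda>p. vector_derivative \<gamma> (at (p$1)))"
    using has_vector_derivative_shift_0[of \<gamma>]
    by (simp add: fun_eq_iff partial_def vector_derivative_def axis_def orbit_surface_def flow_eq)
  have "((\<lambda>h. \<gamma> (p $ 1) + (p $ 2 + h) *\<^sub>R vector [a, b, 0]) has_vector_derivative vector [a, b, 0]) (at 0)"
    for p :: "real^2"
    by (auto intro!: derivative_eq_intros)
  from vector_derivative_at[OF this]
  show "partial 2 (orbit_surface a b \<gamma>) = (\<lambda>p. vector [a, b, 0])"
    by (simp add: fun_eq_iff partial_def axis_def orbit_surface_def flow_eq)
qed

text \<open>The flow translates all points by the same vector, so the partial derivative in flow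
  time is constant and all regularity is that of \<open>\<gamma>\<close>.\<close>

lemma C2_on_orbit_surface:
  "C2_on (strip J) (orbit_surface a b \<gamma>) \<longleftrightarrow>
    (\<forall>s\<in>J. \<gamma> differentiable (at s)) \<and> continuous_on J (\<lambda>s. vector_derivative \<gamma> (at s)) \<and>
    (\<forall>s\<in>J. (\<lambda>s. vector_derivative \<gamma> (at s)) differentiable (at s)) \<and>
    continuous_on J (\<lambda>s. vector_derivative (\<lambda>s. vector_derivative \<gamma> (at s)) (at s))"
proof -
  have "(\<lambda>h. orbit_surface a b \<gamma> (p + h *\<^sub>R axis 1 1)) differentiable at 0 \<longleftrightarrow> \<gamma> differentiable at (p $ 1)"
    for p
    using has_vector_derivative_shift_0[of \<gamma>]
    by (simp add: differentiable_iff_has_vector_derivative axis_def orbit_surface_def flow_eq)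
  moreover have "(\<lambda>h. orbit_surface a b \<gamma> (p + h *\<^sub>R axis 2 1)) differentiable at 0" for p
    by (simp add: axis_def orbit_surface_def flow_eq)
  moreover have "(\<lambda>h. \<gamma> ((p + h *\<^sub>R axis 1 1) $ 1)) differentiable at 0 \<longleftrightarrow> \<gamma> differentiable (at (p $ 1))"
    for p :: "real^2"
    using has_vector_derivative_shift_0[of \<gamma> _ 0]
    by (simp add: differentiable_iff_has_vector_derivative axis_def)
  ultimately have "C1_on (strip J) (orbit_surface a b \<gamma>) \<longleftrightarrow> C1_on (strip J) (\<lambda>p. \<gamma> (p $ 1))"
    unfolding C1_on_def forall_2 partial_orbit_surface partial_profile by (simp add: axis_def)
  moreover have "C1_on (strip J) (\<lambda>p::real^2. (vector [a, b, 0] :: real^3))"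
    using C1_on_profile[of J "\<lambda>s. vector [a, b, 0] :: real^3"] by simp
  ultimately show ?thesis
    unfolding C2_on_def forall_2 partial_orbit_surface C1_on_profile[of J \<gamma>]
      C1_on_profile[of J "\<lambda>s. vector_derivative \<gamma> (at s)"] by auto
qed

section \<open>The translator equation of a framed profile\<close>

lemma sol_metric_exp:
  "sol_metric p v w = (exp (p$3))\<^sup>2 * v$1 * w$1 + v$2 * w$2 / (exp (p$3))\<^sup>2 + v$3 * w$3"
  by (simp add: sol_metric_def exp_double exp_minus field_simps)

text \<open>Unit-speed profile curves, with velocity \<open>(v, u)\<close> in the orthonormal frame
  \<open>e\<^sup>z \<partial>\<^sub>y, \<partial>\<^sub>z\<close>.\<close>

locale framed_profile =
  fixes a b :: real and I :: "real set" and \<gamma> :: "real \<Rightarrow> real^3" and y z u v u' v' :: "real \<Rightarrow> real"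
  assumes ab: "a * b \<noteq> 0"
    and open_I: "open I" and interval_I: "is_interval I" and nonempty_I: "I \<noteq> {}"
    and \<gamma>: "\<And>s. s \<in> I \<Longrightarrow> \<gamma> s = vector [0, y s, z s]"
    and dy: "\<And>s. s \<in> I \<Longrightarrow> (y has_real_derivative exp (z s) * v s) (at s)"
    and dz: "\<And>s. s \<in> I \<Longrightarrow> (z has_real_derivative u s) (at s)"
    and du: "\<And>s. s \<in> I \<Longrightarrow> (u has_real_derivative u' s) (at s)"
    and dv: "\<And>s. s \<in> I \<Longrightarrow> (v has_real_derivative v' s) (at s)"
    and cu': "continuous_on I u'" and cv': "continuous_on I v'"
    and unit: "\<And>s. s \<in> I \<Longrightarrow> (u s)\<^sup>2 + (v s)\<^sup>2 = 1"
begin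

abbreviation \<Psi> :: "real^2 \<Rightarrow> real^3" where "\<Psi> \<equiv> orbit_surface a b \<gamma>"

lemma a: "a \<noteq> 0" and b: "b \<noteq> 0"
  using ab by auto

lemma continuous_on_derivs:
  "continuous_on I y" "continuous_on I z" "continuous_on I u" "continuous_on I v"
  using DERIV_isCont[OF dy] DERIV_isCont[OF dz] DERIV_isCont[OF du] DERIV_isCont[OF dv]
  by (simp_all add: continuous_at_imp_continuous_on)

lemma \<gamma>_deriv:
  assumes "s \<in> I"
  shows "(\<gamma> has_vector_derivative vector [0, exp (z s) * v s, u s]) (at s)"
proof -
  have "((\<lambda>s. vector [0, y s, z s] :: real^3) has_vector_derivative
      vector [0, exp (z s) * v s, u s]) (at s)"
    using assms by (intro has_vector_derivative_vector_3 dy dz) auto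
  then show ?thesis
    by (rule has_vector_derivative_transform_within_open[OF _ open_I assms]) (simp add: \<gamma>)
qed

lemma \<gamma>_deriv2:
  assumes "s \<in> I"
  shows "((\<lambda>s. vector_derivative \<gamma> (at s)) has_vector_derivative
    vector [0, exp (z s) * (u s * v s + v' s), u' s]) (at s)"
proof -
  have "((\<lambda>s. vector [0, exp (z s) * v s, u s] :: real^3) has_vector_derivative
      vector [0, exp (z s) * (u s * v s + v' s), u' s]) (at s)"
    using assms
    by (intro has_vector_derivative_vector_3 du)
      (auto intro!: derivative_eq_intros dz dv simp: algebra_simps)
  then show ?thesis
    by (rule has_vector_derivative_transform_within_open[OF _ open_I assms])
      (simp add: vector_derivative_at[OF \<gamma>_deriv])
qed

lemmas vector_derivative_\<gamma> = vector_derivative_at[OF \<gamma>_deriv] vector_derivative_at[OF \<gamma>_deriv2]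

lemma \<Psi>_eq: "p$1 \<in> I \<Longrightarrow> \<Psi> p = vector [a * p$2, y (p$1) + b * p$2, z (p$1)]"
  by (simp add: orbit_surface_def flow_def \<gamma>)

lemma immersed: "immersed_surface (strip I) \<Psi>"
  unfolding immersed_surface_def
proof (intro conjI ballI allI impI)
  have strip: "strip I = (\<lambda>p. p$1) -` I"
    by (auto simp: strip_def)
  show "open (strip I)"
    unfolding strip by (intro open_vimage open_I continuous_intros)
  have "convex (strip I)"
    unfolding strip using interval_I
    by (intro convex_linear_vimage) (auto simp: is_interval_convex_1 intro: bounded_linear.linear bounded_linear_vec_nth)
  then show "connected (strip I)"
    by (rule convex_connected)
  obtain s where "s \<in> I"
    using nonempty_I by blast
  then have "axis 1 s \<in> strip I"
    by (simp add: strip_def axis_def)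
  then show "strip I \<noteq> {}"
    by blast
  show "C2_on (strip I) \<Psi>"
    unfolding C2_on_orbit_surface
  proof (intro conjI ballI)
    show "\<gamma> differentiable (at s)" if "s \<in> I" for s
      using \<gamma>_deriv[OF that] by (auto simp: differentiable_iff_has_vector_derivative)
    show "(\<lambda>s. vector_derivative \<gamma> (at s)) differentiable (at s)" if "s \<in> I" for s
      using \<gamma>_deriv2[OF that] by (auto simp: differentiable_iff_has_vector_derivative)
    have "continuous_on I (\<lambda>s. vector [0, exp (z s) * v s, u s] :: real^3)"
      unfolding vector_3_axis by (intro continuous_intros continuous_on_derivs)
    then show "continuous_on I (\<lambda>s. vector_derivative \<gamma> (at s))"
      by (simp add: vector_derivative_\<gamma> cong: continuous_on_cong)
    have "continuous_on I (\<lambda>s. vector [0, exp (z s) * (u s * v s + v' s), u' s] :: real^3)"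
      unfolding vector_3_axis by (intro continuous_intros continuous_on_derivs cu' cv')
    then show "continuous_on I (\<lambda>s. vector_derivative (\<lambda>s. vector_derivative \<gamma> (at s)) (at s))"
      by (simp add: vector_derivative_\<gamma> cong: continuous_on_cong)
  qed
next
  fix p :: "real^2" and c :: "real^2"
  assume p: "p \<in> strip I" and c: "(\<Sum>i\<in>UNIV. c $ i *\<^sub>R partial i \<Psi> p) = 0"
  then have s: "p$1 \<in> I" by (simp add: strip_def)
  \<comment> \<open>The first coordinate of the combination is \<open>a * c$2\<close>, which removes
    the flow direction; what remains is \<open>c$1\<close> times the unit velocity of the
    profile.\<close>
  from c have c12: "c$1 = 0 \<or> v (p$1) = 0" "c$1 = 0 \<or> u (p$1) = 0" "c$2 = 0"
    using a by (auto simp: sum_2 partial_orbit_surface vector_derivative_\<gamma>[OF s] vec_eq_iff forall_3)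
  then have "c$1 = 0"
    using unit[OF s] by auto
  with c12 show "c = 0"
    by (simp add: vec_eq_iff forall_2)
qed

text \<open>The Riemannian cross product of the two coordinate tangent vectors, written in the
  coordinates (x, y, z). It is the same at all flow times.\<close>

definition normal :: "real \<Rightarrow> real^3" where
  "normal s = vector [- b * u s / (exp (z s))\<^sup>2, a * (exp (z s))\<^sup>2 * u s, - a * exp (z s) * v s]"

text \<open>The determinant of the first fundamental form, which is also the squared length of
  \<open>normal\<close>.\<close>

definition area_sq :: "real \<Rightarrow> real" where
  "area_sq s = a\<^sup>2 * (exp (z s))\<^sup>2 + b\<^sup>2 * (u s)\<^sup>2 / (exp (z s))\<^sup>2"

lemma area_sq_pos: "0 < area_sq s"
  using a by (auto simp: area_sq_def intro!: add_pos_nonneg)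

lemma continuous_on_area_sq: "continuous_on I area_sq"
  unfolding area_sq_def by (intro continuous_intros continuous_on_derivs) simp

text \<open>The factor \<open>l\<close> is kept because the field \<open>\<nu>\<close> provided by
  \<open>translator\<close> is known only pointwise up to a scalar. No derivative of
  \<open>\<nu>\<close> enters the second fundamental form, so its value at \<open>p\<close> is
  enough.\<close>

lemma mean_curvature_multiple:
  assumes p: "p \<in> strip I" and s: "s = p$1" and \<nu>: "\<nu> p = l *\<^sub>R normal s"
  shows "mean_curvature \<Psi> \<nu> p = l * (a * exp (z s) * (2 * b\<^sup>2 * (u s)\<^sup>2 * v s / (exp (z s))\<^sup>2 -
    (a\<^sup>2 * (exp (z s))\<^sup>2 + b\<^sup>2 / (exp (z s))\<^sup>2) * (v s * u' s - u s * v' s))) / area_sq s"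
proof -
  have sI: "p$1 \<in> I" and sI': "s \<in> I" using p s by (simp_all add: strip_def)
  define P where "P = exp (z s)"
  have P: "P \<noteq> 0" by (simp add: P_def)
  define g where "g = first_form \<Psi> p"
  define h where "h = second_form \<Psi> \<nu> p"
  have \<Psi>3: "\<Psi> p $ 3 = z s" by (simp add: \<Psi>_eq[OF sI] s)
  have T: "partial 1 \<Psi> p = vector [0, P * v s, u s]" "partial 2 \<Psi> p = vector [a, b, 0]"
    "partial 1 (partial 1 \<Psi>) p = vector [0, P * (u s * v s + v' s), u' s]"
    "partial 2 (partial 1 \<Psi>) p = 0" "partial 1 (partial 2 \<Psi>) p = 0" "partial 2 (partial 2 \<Psi>) p = 0"
    using vector_derivative_\<gamma>[OF sI] partial_profile[of "\<lambda>s. vector_derivative \<gamma> (at s)"]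
      partial_profile[of "\<lambda>s. vector [a, b, 0] :: real^3"]
    by (simp_all add: partial_orbit_surface P_def s)
  have v2: "(v s)\<^sup>2 = 1 - (u s)\<^sup>2" using unit[OF sI'] by simp
  have e: "exp (2 * z s) = P\<^sup>2" "exp (- (2 * z s)) = 1 / P\<^sup>2"
    by (simp_all add: P_def exp_double exp_minus inverse_eq_divide)
  have g: "g$1$1 = 1" "g$1$2 = b * v s / P" "g$2$1 = b * v s / P" "g$2$2 = a\<^sup>2 * P\<^sup>2 + b\<^sup>2 / P\<^sup>2"
    using P unit[OF sI']
    by (simp_all add: g_def first_form_def sol_metric_exp \<Psi>3 T flip: P_def)
      (simp_all add: field_simps power2_eq_square)
  have "h$1$1 = l * (a * P * (u s * (v' s - u s * v s) - v s * (u' s + v s * v s)))"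
    using P by (simp add: h_def second_form_def sol_metric_exp \<Psi>3 cov_deriv_eq T e Let_def \<nu> normal_def flip: P_def)
      (simp add: field_simps power2_eq_square)
  also have "u s * (v' s - u s * v s) - v s * (u' s + v s * v s) =
      u s * v' s - v s * u' s - v s * ((u s)\<^sup>2 + (v s)\<^sup>2)"
    by (simp add: algebra_simps power2_eq_square)
  finally have h11: "h$1$1 = l * (a * P * (u s * v' s - v s * u' s - v s))"
    using unit[OF sI'] by simp
  have h12: "h$1$2 = l * (- a * b * (1 + (u s)\<^sup>2))" "h$2$1 = l * (- a * b * (1 + (u s)\<^sup>2))"
    using P v2 by (simp_all add: h_def second_form_def sol_metric_exp \<Psi>3 cov_deriv_eq T e Let_def \<nu> normal_def flip: P_def)
      (simp_all add: field_simps v2[unfolded power2_eq_square] power2_eq_square)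
  have h22: "h$2$2 = l * (a * P * v s * (a\<^sup>2 * P\<^sup>2 - b\<^sup>2 / P\<^sup>2))"
    using P by (simp add: h_def second_form_def sol_metric_exp \<Psi>3 cov_deriv_eq T e Let_def \<nu> normal_def flip: P_def)
      (simp add: field_simps power2_eq_square)
  have det: "g$1$1 * g$2$2 - g$1$2 * g$2$1 = area_sq s"
  proof -
    have "g$1$1 * g$2$2 - g$1$2 * g$2$1 = a\<^sup>2 * P\<^sup>2 + b\<^sup>2 * (1 - (v s)\<^sup>2) / P\<^sup>2"
      using P by (simp add: g field_simps power2_eq_square)
    then show ?thesis
      by (simp add: v2 area_sq_def flip: P_def)
  qed
  have "mean_curvature \<Psi> \<nu> p = (g$2$2 * h$1$1 - g$1$2 * h$2$1 - g$2$1 * h$1$2 + g$1$1 * h$2$2) / area_sq s"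
    using trace_matrix_inv_2[of g h] area_sq_pos[of s]
    by (simp add: mean_curvature_def g_def h_def flip: det)
  also have "g$2$2 * h$1$1 - g$1$2 * h$2$1 - g$2$1 * h$1$2 + g$1$1 * h$2$2 =
     l * (a * P * (2 * b\<^sup>2 * (u s)\<^sup>2 * v s / P\<^sup>2 -
    (a\<^sup>2 * P\<^sup>2 + b\<^sup>2 / P\<^sup>2) * (v s * u' s - u s * v' s)))"
    unfolding g h11 h12 h22 using P by (simp add: field_simps power2_eq_square)
  finally show ?thesis
    by (simp add: P_def)
qed

lemma normal_orth:
  assumes p: "p \<in> strip I" and s: "s = p$1"
  shows "sol_metric (\<Psi> p) (normal s) (partial i \<Psi> p) = 0"
    and "sol_metric (\<Psi> p) (normal s) (normal s) = area_sq s"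
proof -
  have sI: "p$1 \<in> I" using p by (simp add: strip_def)
  have "\<forall>i. sol_metric (\<Psi> p) (normal s) (partial i \<Psi> p) = 0"
    unfolding forall_2
    by (simp add: sol_metric_exp \<Psi>_eq[OF sI] partial_orbit_surface vector_derivative_\<gamma>[OF sI] normal_def s
        power2_eq_square)
  then show "sol_metric (\<Psi> p) (normal s) (partial i \<Psi> p) = 0" by blast
  have v2: "(v s)\<^sup>2 = 1 - (u s)\<^sup>2" using unit[OF sI] s by simp
  have "sol_metric (\<Psi> p) (normal s) (normal s) =
      b\<^sup>2 * (u s)\<^sup>2 / (exp (z s))\<^sup>2 + a\<^sup>2 * (exp (z s))\<^sup>2 * (u s)\<^sup>2 + a\<^sup>2 * (exp (z s))\<^sup>2 * (v s)\<^sup>2"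
    by (simp add: sol_metric_exp \<Psi>_eq[OF sI] normal_def power_mult_distrib flip: s)
      (simp add: power2_eq_square)
  then show "sol_metric (\<Psi> p) (normal s) (normal s) = area_sq s"
    unfolding v2 by (simp add: area_sq_def algebra_simps)
qed

lemma normal_unique:
  assumes p: "p \<in> strip I" and s: "s = p$1"
    and orth: "\<And>i. sol_metric (\<Psi> p) w (partial i \<Psi> p) = 0"
  obtains l where "w = l *\<^sub>R normal s"
proof -
  have sI: "p$1 \<in> I" and sI': "s \<in> I" using p s by (simp_all add: strip_def)
  define P where "P = exp (z s)"
  have P: "P \<noteq> 0" by (simp add: P_def)
  have v2: "(v s)\<^sup>2 = 1 - (u s)\<^sup>2" using unit[OF sI'] by simp
  from orth[of 1] have o1: "w$2 * v s + P * u s * w$3 = 0"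
    using P by (simp add: sol_metric_exp \<Psi>_eq[OF sI] partial_orbit_surface vector_derivative_\<gamma>[OF sI']
        flip: s P_def) (simp add: field_simps power2_eq_square)
  from orth[of 2] have o2: "w$1 = - b * w$2 / (a * P ^ 4)"
    using P a by (simp add: sol_metric_exp \<Psi>_eq[OF sI] partial_orbit_surface
        flip: s P_def) (simp add: field_simps eval_nat_numeral)
  \<comment> \<open>In the orthonormal frame the last two components of \<open>normal\<close> are
    \<open>a * P\<close> times \<open>(u s, - v s)\<close>, and those of \<open>w\<close> are
    \<open>(w$2 / P, w$3)\<close>; \<open>l\<close> projects the latter on the unit vector
    \<open>(u s, - v s)\<close>.\<close>
  define l where "l = (w$2 * u s / P - w$3 * v s) / (a * P)"
  have l2: "l * (a * P\<^sup>2 * u s) = w$2"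
  proof -
    have "l * (a * P\<^sup>2 * u s) = w$2 * (u s)\<^sup>2 - (P * u s * w$3) * v s"
      using P a by (simp add: l_def field_simps power2_eq_square)
    also have "P * u s * w$3 = - (w$2 * v s)" using o1 by simp
    also have "w$2 * (u s)\<^sup>2 - (- (w$2 * v s)) * v s = w$2 * ((u s)\<^sup>2 + (v s)\<^sup>2)"
      by (simp add: algebra_simps power2_eq_square)
    finally show ?thesis using unit[OF sI'] by simp
  qed
  have l3: "l * (- a * P * v s) = w$3"
  proof -
    have "l * (- a * P * v s) = w$3 * (v s)\<^sup>2 - (w$2 * v s) * u s / P"
      using P a by (simp add: l_def field_simps power2_eq_square)
    also have "w$2 * v s = - (P * u s * w$3)" using o1 by simp
    also have "w$3 * (v s)\<^sup>2 - (- (P * u s * w$3)) * u s / P = w$3 * ((u s)\<^sup>2 + (v s)\<^sup>2)"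
      using P by (simp add: field_simps power2_eq_square)
    finally show ?thesis using unit[OF sI'] by simp
  qed
  have l1: "l * (- b * u s / P\<^sup>2) = w$1"
    unfolding o2 l2[symmetric] using P a by (simp add: field_simps eval_nat_numeral)
  show ?thesis
    by (rule that[of l]) (use l1 l2 l3 in \<open>simp add: normal_def vec_eq_iff forall_3 flip: P_def\<close>)
qed

text \<open>The metric weights cancel those of \<open>normal\<close>. The parts
  \<open>- x \<partial>x\<close> and \<open>y \<partial>y\<close> of \<open>F3\<close> meet
  coefficients of opposite sign, so their contributions \<open>a b c3 t u\<close> add up instead of
  cancelling.\<close>

lemma normal_killing:
  assumes p: "p \<in> strip I" and s: "s = p$1"
    and V: "\<And>q. V q = c1 *\<^sub>R F1 q + c2 *\<^sub>R F2 q + c3 *\<^sub>R F3 q"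
  shows "sol_metric (\<Psi> p) (normal s) (V (\<Psi> p)) =
    u s * (a * c2 - b * c1 + a * c3 * y s + 2 * a * b * c3 * p$2) - a * c3 * exp (z s) * v s"
proof -
  have sI: "p$1 \<in> I" using p by (simp add: strip_def)
  show ?thesis
    by (simp add: sol_metric_exp \<Psi>_eq[OF sI] normal_def V F1_def F2_def F3_def flip: s)
      (simp add: algebra_simps)
qed

text \<open>The equation for the unnormalized normal, cleared of the denominator
  \<open>area_sq s\<close>. The time \<open>t\<close> remains because \<open>F3\<close>, unlike
  \<open>F1\<close> and \<open>F2\<close>, varies along the flow.\<close>

definition translator_eq :: "real \<Rightarrow> real \<Rightarrow> real \<Rightarrow> real \<Rightarrow> real \<Rightarrow> bool" where
  "translator_eq c1 c2 c3 s t \<longleftrightarrow>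
    a * exp (z s) * (2 * b\<^sup>2 * (u s)\<^sup>2 * v s / (exp (z s))\<^sup>2 -
      (a\<^sup>2 * (exp (z s))\<^sup>2 + b\<^sup>2 / (exp (z s))\<^sup>2) * (v s * u' s - u s * v' s)) =
    area_sq s * (u s * (a * c2 - b * c1 + a * c3 * y s + 2 * a * b * c3 * t) - a * c3 * exp (z s) * v s)"

text \<open>Both sides of the translator equation are linear in the normal, so any nonzero factor
  cancels, whatever its sign. For the converse, normalizing \<open>normal\<close> gives a continuous
  unit field.\<close>

lemma translator_iff:
  assumes V: "\<And>q. V q = c1 *\<^sub>R F1 q + c2 *\<^sub>R F2 q + c3 *\<^sub>R F3 q"
  shows "translator V (strip I) \<Psi> \<longleftrightarrow> (\<forall>s\<in>I. \<forall>t. translator_eq c1 c2 c3 s t)"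
proof -
  have linear: "sol_metric q (l *\<^sub>R w) w' = l * sol_metric q w w'"
    "sol_metric q w (l *\<^sub>R w') = l * sol_metric q w w'" for q l w w'
    by (simp_all add: sol_metric_def algebra_simps)
  have cancel: "l * X / W = l * Y \<longleftrightarrow> X = W * Y" if "l \<noteq> 0" "0 < W" for l W X Y :: real
    using that by (auto simp: field_simps)
  have pointwise: "mean_curvature \<Psi> \<nu> p = sol_metric (\<Psi> p) (\<nu> p) (V (\<Psi> p)) \<longleftrightarrow>
      translator_eq c1 c2 c3 (p$1) (p$2)"
    if "p \<in> strip I" "\<nu> p = l *\<^sub>R normal (p$1)" "l \<noteq> 0" for \<nu> p l
    unfolding mean_curvature_multiple[where \<nu> = \<nu>, OF \<open>p \<in> strip I\<close> refl \<open>\<nu> p = l *\<^sub>R normal (p$1)\<close>]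
      \<open>\<nu> p = l *\<^sub>R normal (p$1)\<close> linear normal_killing[OF \<open>p \<in> strip I\<close> refl V] translator_eq_def
    by (rule cancel[OF \<open>l \<noteq> 0\<close> area_sq_pos])
  define \<nu>0 where "\<nu>0 p = (1 / sqrt (area_sq (p$1))) *\<^sub>R normal (p$1)" for p :: "real^2"
  have "unit_normal (strip I) \<Psi> \<nu>0"
    unfolding unit_normal_def
  proof (intro conjI ballI allI)
    have c: "continuous_on (strip I) (\<lambda>p. f (p$1))" if "continuous_on I f" for f :: "real \<Rightarrow> real"
      by (rule continuous_on_compose2[OF that]) (auto simp: strip_def intro!: continuous_intros)
    show "continuous_on (strip I) \<nu>0"
      unfolding \<nu>0_def normal_def vector_3_axis
      using area_sq_pos
      by (intro continuous_intros c continuous_on_derivs continuous_on_area_sq) (simp_all add: less_imp_neq[symmetric])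
    fix p assume p: "p \<in> strip I"
    show "sol_metric (\<Psi> p) (\<nu>0 p) (\<nu>0 p) = 1"
      using area_sq_pos[of "p$1"]
      unfolding \<nu>0_def linear normal_orth(2)[OF p refl]
      by (simp add: field_simps)
    show "sol_metric (\<Psi> p) (\<nu>0 p) (partial i \<Psi> p) = 0" for i
      unfolding \<nu>0_def linear normal_orth(1)[OF p refl] by simp
  qed
  note \<nu>0 = this
  show ?thesis
  proof
    assume "translator V (strip I) \<Psi>"
    then obtain \<nu> where \<nu>: "unit_normal (strip I) \<Psi> \<nu>"
      "\<And>p. p \<in> strip I \<Longrightarrow> mean_curvature \<Psi> \<nu> p = sol_metric (\<Psi> p) (\<nu> p) (V (\<Psi> p))"
      unfolding translator_def by blast
    show "\<forall>s\<in>I. \<forall>t. translator_eq c1 c2 c3 s t"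
    proof (intro ballI allI)
      fix s t assume "s \<in> I"
      define p :: "real^2" where "p = vector [s, t]"
      have p: "p \<in> strip I" "p$1 = s" "p$2 = t"
        using \<open>s \<in> I\<close> by (simp_all add: p_def strip_def)
      have n: "sol_metric (\<Psi> p) (\<nu> p) (\<nu> p) = 1" "\<And>i. sol_metric (\<Psi> p) (\<nu> p) (partial i \<Psi> p) = 0"
        using \<nu>(1) p(1) unfolding unit_normal_def by blast+
      obtain l where l: "\<nu> p = l *\<^sub>R normal (p$1)"
        using normal_unique[OF p(1) refl n(2)] .
      moreover have "l \<noteq> 0"
        using n(1) unfolding l linear by auto
      ultimately show "translator_eq c1 c2 c3 s t"
        using pointwise[where \<nu> = \<nu>, OF p(1) l] \<nu>(2)[OF p(1)] p by simp
    qed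
  next
    assume *: "\<forall>s\<in>I. \<forall>t. translator_eq c1 c2 c3 s t"
    have "mean_curvature \<Psi> \<nu>0 p = sol_metric (\<Psi> p) (\<nu>0 p) (V (\<Psi> p))" if "p \<in> strip I" for p
      using * that area_sq_pos[of "p$1"]
      by (subst pointwise[where \<nu> = \<nu>0, OF that \<nu>0_def]) (auto simp: strip_def)
    with \<nu>0 immersed show "translator V (strip I) \<Psi>"
      unfolding translator_def by blast
  qed
qed

end

section \<open>Global solutions of the profile system\<close>

text \<open>Boundedness is included because Lipschitz functions alone are not closed under
  products.\<close>

definition bounded_lipschitz :: "'a::metric_space set \<Rightarrow> ('a \<Rightarrow> real) \<Rightarrow> bool" where
  "bounded_lipschitz S f \<longleftrightarrow> bounded (f ` S) \<and> (\<exists>L. L-lipschitz_on S f)"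

lemma bounded_lipschitz_iff:
  "bounded_lipschitz S f \<longleftrightarrow> (\<exists>C\<ge>0. (\<forall>x\<in>S. \<bar>f x\<bar> \<le> C) \<and> (\<forall>x\<in>S. \<forall>y\<in>S. \<bar>f x - f y\<bar> \<le> C * dist x y))"
proof
  assume "bounded_lipschitz S f"
  then obtain B L where B: "\<And>x. x \<in> S \<Longrightarrow> \<bar>f x\<bar> \<le> B" and L: "L-lipschitz_on S f"
    by (auto simp: bounded_lipschitz_def bounded_iff)
  define C where "C = max B L"
  have "\<bar>f x - f y\<bar> \<le> C * dist x y" if "x \<in> S" "y \<in> S" for x y
  proof -
    have "\<bar>f x - f y\<bar> \<le> L * dist x y"
      using lipschitz_onD[OF L that] by (simp add: dist_real_def)
    also have "\<dots> \<le> C * dist x y"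
      by (intro mult_right_mono) (auto simp: C_def)
    finally show ?thesis .
  qed
  moreover have "\<bar>f x\<bar> \<le> C" if "x \<in> S" for x
    using B[OF that] by (simp add: C_def)
  moreover have "0 \<le> C"
    using lipschitz_on_nonneg[OF L] by (simp add: C_def)
  ultimately show "\<exists>C\<ge>0. (\<forall>x\<in>S. \<bar>f x\<bar> \<le> C) \<and> (\<forall>x\<in>S. \<forall>y\<in>S. \<bar>f x - f y\<bar> \<le> C * dist x y)"
    by blast
next
  assume "\<exists>C\<ge>0. (\<forall>x\<in>S. \<bar>f x\<bar> \<le> C) \<and> (\<forall>x\<in>S. \<forall>y\<in>S. \<bar>f x - f y\<bar> \<le> C * dist x y)"
  then obtain C where C: "0 \<le> C" "\<forall>x\<in>S. \<bar>f x\<bar> \<le> C" "\<forall>x\<in>S. \<forall>y\<in>S. \<bar>f x - f y\<bar> \<le> C * dist x y"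
    by blast
  have "C-lipschitz_on S f"
    using C by (intro lipschitz_onI) (auto simp: dist_real_def)
  then show "bounded_lipschitz S f"
    using C by (auto simp: bounded_lipschitz_def bounded_iff)
qed

lemma bounded_lipschitz_const: "bounded_lipschitz S (\<lambda>x. c)"
  unfolding bounded_lipschitz_iff by (intro exI[of _ "\<bar>c\<bar>"]) auto

lemma bounded_lipschitz_add:
  assumes "bounded_lipschitz S f" "bounded_lipschitz S g"
  shows "bounded_lipschitz S (\<lambda>x. f x + g x)"
  using assms bounded_plus_comp[of f S g] lipschitz_on_add[of _ S f _ g]
  unfolding bounded_lipschitz_def by blast

lemma bounded_lipschitz_mult:
  assumes "bounded_lipschitz S f" "bounded_lipschitz S g"
  shows "bounded_lipschitz S (\<lambda>x. f x * g x)"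
proof -
  obtain C where C: "0 \<le> C" "\<And>x. x \<in> S \<Longrightarrow> \<bar>f x\<bar> \<le> C"
    "\<And>x y. x \<in> S \<Longrightarrow> y \<in> S \<Longrightarrow> \<bar>f x - f y\<bar> \<le> C * dist x y"
    using assms(1) unfolding bounded_lipschitz_iff by blast
  obtain D where D: "0 \<le> D" "\<And>x. x \<in> S \<Longrightarrow> \<bar>g x\<bar> \<le> D"
    "\<And>x y. x \<in> S \<Longrightarrow> y \<in> S \<Longrightarrow> \<bar>g x - g y\<bar> \<le> D * dist x y"
    using assms(2) unfolding bounded_lipschitz_iff by blast
  have "\<bar>f x * g x\<bar> \<le> C * D" if "x \<in> S" for x
    unfolding abs_mult using C D that by (intro mult_mono) auto
  then have "bounded ((\<lambda>x. f x * g x) ` S)"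
    by (auto simp: bounded_iff)
  moreover have "(2 * (C * D))-lipschitz_on S (\<lambda>x. f x * g x)"
  proof (rule lipschitz_onI)
    fix x y assume xy: "x \<in> S" "y \<in> S"
    have "f x * g x - f y * g y = f x * (g x - g y) + g y * (f x - f y)"
      by (simp add: algebra_simps)
    then have "\<bar>f x * g x - f y * g y\<bar> \<le> \<bar>f x\<bar> * \<bar>g x - g y\<bar> + \<bar>g y\<bar> * \<bar>f x - f y\<bar>"
      by (metis abs_mult abs_triangle_ineq)
    also have "\<dots> \<le> C * (D * dist x y) + D * (C * dist x y)"
      using C D xy by (intro add_mono mult_mono) auto
    finally show "dist (f x * g x) (f y * g y) \<le> 2 * (C * D) * dist x y"
      by (simp add: dist_real_def algebra_simps)
  qed (use C D in simp)
  ultimately show ?thesis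
    unfolding bounded_lipschitz_def by blast
qed

lemma bounded_lipschitz_diff:
  assumes "bounded_lipschitz S f" "bounded_lipschitz S g"
  shows "bounded_lipschitz S (\<lambda>x. f x - g x)"
  using bounded_lipschitz_add[OF assms(1) bounded_lipschitz_mult[OF bounded_lipschitz_const[of S "-1"] assms(2)]]
  by simp

lemma bounded_lipschitz_minus:
  assumes "bounded_lipschitz S f"
  shows "bounded_lipschitz S (\<lambda>x. - f x)"
  using bounded_lipschitz_diff[OF bounded_lipschitz_const[of S 0] assms] by simp

lemma bounded_lipschitz_power:
  assumes "bounded_lipschitz S f"
  shows "bounded_lipschitz S (\<lambda>x. f x ^ n)"
  by (induction n) (auto intro: bounded_lipschitz_const bounded_lipschitz_mult assms)

lemma bounded_lipschitz_divide:
  assumes f: "bounded_lipschitz S f" and g: "bounded_lipschitz S g"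
    and c: "0 < c" "\<And>x. x \<in> S \<Longrightarrow> c \<le> g x"
  shows "bounded_lipschitz S (\<lambda>x. f x / g x)"
proof -
  obtain D where D: "0 \<le> D" "\<And>x y. x \<in> S \<Longrightarrow> y \<in> S \<Longrightarrow> \<bar>g x - g y\<bar> \<le> D * dist x y"
    using g unfolding bounded_lipschitz_iff by blast
  have "\<bar>1 / g x\<bar> \<le> 1 / c" if "x \<in> S" for x
    using c(1) c(2)[OF that] by (simp add: frac_le)
  then have "bounded ((\<lambda>x. 1 / g x) ` S)"
    unfolding bounded_iff by auto
  moreover have "(D / c\<^sup>2)-lipschitz_on S (\<lambda>x. 1 / g x)"
  proof (rule lipschitz_onI)
    fix x y assume xy: "x \<in> S" "y \<in> S"
    have pos: "c \<le> g x" "c \<le> g y" "0 < g x" "0 < g y"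
      using c xy by (auto intro: less_le_trans)
    then have "1 / g x - 1 / g y = (g y - g x) / (g x * g y)"
      by (simp add: field_simps)
    then have "\<bar>1 / g x - 1 / g y\<bar> = \<bar>g y - g x\<bar> / (g x * g y)"
      using pos by (simp add: abs_mult)
    also have "\<dots> \<le> (D * dist x y) / c\<^sup>2"
      using D(2)[OF xy] pos c(1) D(1) unfolding power2_eq_square
      by (intro frac_le mult_mono) (auto simp: abs_minus_commute)
    finally show "dist (1 / g x) (1 / g y) \<le> D / c\<^sup>2 * dist x y"
      by (simp add: dist_real_def)
  qed (use D in simp)
  ultimately have "bounded_lipschitz S (\<lambda>x. 1 / g x)"
    unfolding bounded_lipschitz_def by blast
  from bounded_lipschitz_mult[OF f this] show ?thesis
    by simp
qed

text \<open>Only the compact range of \<open>f\<close> matters, and \<open>\<phi>'\<close> is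
  bounded there; so the exponential is covered although it is not Lipschitz on the line.\<close>

lemma bounded_lipschitz_compose:
  assumes f: "bounded_lipschitz S f"
    and \<phi>: "\<And>t. (\<phi> has_real_derivative \<phi>' t) (at t)" and \<phi>': "continuous_on UNIV \<phi>'"
  shows "bounded_lipschitz S (\<lambda>x. \<phi> (f x))"
proof -
  obtain C where C: "0 \<le> C" "\<And>x. x \<in> S \<Longrightarrow> \<bar>f x\<bar> \<le> C"
    "\<And>x y. x \<in> S \<Longrightarrow> y \<in> S \<Longrightarrow> \<bar>f x - f y\<bar> \<le> C * dist x y"
    using f unfolding bounded_lipschitz_iff by blast
  have mem: "f x \<in> {-C..C}" if "x \<in> S" for x
    using C(2)[OF that] by (simp add: abs_le_iff minus_le_iff)
  have "continuous_on {-C..C} \<phi>"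
    using DERIV_isCont[OF \<phi>] by (simp add: continuous_at_imp_continuous_on)
  then have "bounded (\<phi> ` {-C..C})"
    by (intro compact_imp_bounded compact_continuous_image) auto
  then have "bounded ((\<lambda>x. \<phi> (f x)) ` S)"
    by (rule bounded_subset) (use mem in auto)
  moreover have "bounded (\<phi>' ` {-C..C})"
    by (intro compact_imp_bounded compact_continuous_image continuous_on_subset[OF \<phi>']) auto
  then obtain K where K: "\<And>t. t \<in> {-C..C} \<Longrightarrow> \<bar>\<phi>' t\<bar> \<le> K"
    by (auto simp: bounded_iff simp del: atLeastAtMost_iff)
  have K0: "0 \<le> K"
    using K[of 0] C(1) by auto
  have "(K * C)-lipschitz_on S (\<lambda>x. \<phi> (f x))"
  proof (rule lipschitz_onI)
    fix x y assume xy: "x \<in> S" "y \<in> S"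
    have "norm (\<phi> (f x) - \<phi> (f y)) \<le> K * norm (f x - f y)"
      by (rule field_differentiable_bound[of "{-C..C}" \<phi> \<phi>'])
        (use mem[OF xy(1)] mem[OF xy(2)] K in \<open>auto intro: DERIV_subset[OF \<phi>]\<close>)
    also have "\<dots> \<le> K * (C * dist x y)"
      using C(3)[OF xy] K0 by (intro mult_left_mono) auto
    finally show "dist (\<phi> (f x)) (\<phi> (f y)) \<le> K * C * dist x y"
      by (simp add: dist_real_def)
  qed (use K0 C in simp)
  ultimately show ?thesis
    unfolding bounded_lipschitz_def by blast
qed

lemma lipschitz_on_Pair_ex:
  assumes "\<exists>L. L-lipschitz_on S f" "\<exists>L. L-lipschitz_on S g"
  shows "\<exists>L. L-lipschitz_on S (\<lambda>x. (f x, g x))"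
  using assms lipschitz_on_Pair by blast

section \<open>The autonomous system for height and direction\<close>

text \<open>For \<open>(u, v) = (sin \<theta>, cos \<theta>)\<close> this is the derivative of
  \<open>\<theta>\<close> dictated by the translator equation with \<open>c3 = 0\<close> and
  \<open>k = a * c2 - b * c1\<close>. Every term of the numerator contains \<open>u\<close>, so
  horizontal directions are stationary.\<close>

definition angular_speed :: "real \<Rightarrow> real \<Rightarrow> real \<Rightarrow> real \<Rightarrow> real \<Rightarrow> real \<Rightarrow> real" where
  "angular_speed a b k z u v =
    (2 * b\<^sup>2 * (exp (- z))\<^sup>2 * u\<^sup>2 * v -
      k / a * exp (- z) * u * (a\<^sup>2 * (exp z)\<^sup>2 + b\<^sup>2 * (exp (- z))\<^sup>2 * u\<^sup>2)) /
    (a\<^sup>2 * (exp z)\<^sup>2 + b\<^sup>2 * (exp (- z))\<^sup>2)"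

definition frame_field :: "real \<Rightarrow> real \<Rightarrow> real \<Rightarrow> real \<times> real \<times> real \<Rightarrow> real \<times> real \<times> real" where
  "frame_field a b k = (\<lambda>(z, u, v). (u, v * angular_speed a b k z u v, - u * angular_speed a b k z u v))"

lemma bounded_lipschitz_angular_speed:
  assumes "a * b \<noteq> 0"
    and z: "bounded_lipschitz S z" and u: "bounded_lipschitz S u" and v: "bounded_lipschitz S v"
  shows "bounded_lipschitz S (\<lambda>x. angular_speed a b k (z x) (u x) (v x))"
proof -
  have "((\<lambda>x. exp x) has_real_derivative exp t) (at t)" for t :: real
    by (rule DERIV_exp)
  note exp = bounded_lipschitz_compose[OF _ this continuous_on_exp[OF continuous_on_id]]
  \<comment> \<open>Arithmetic-geometric mean: the two exponentials are reciprocal, so the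
    denominator of \<open>angular_speed\<close> stays away from 0 uniformly in the height.\<close>
  have "2 * \<bar>a * b\<bar> \<le> a\<^sup>2 * (exp t)\<^sup>2 + b\<^sup>2 * (exp (- t))\<^sup>2" for t :: real
  proof -
    have "exp t * exp (- t) = 1"
      by (simp flip: exp_add)
    then have "2 * \<bar>a * b\<bar> = 2 * (\<bar>a\<bar> * exp t) * (\<bar>b\<bar> * exp (- t))"
      by (simp add: abs_mult mult_ac)
    also have "\<dots> \<le> (\<bar>a\<bar> * exp t)\<^sup>2 + (\<bar>b\<bar> * exp (- t))\<^sup>2"
      by (rule sum_squares_bound)
    finally show ?thesis
      by (simp add: power_mult_distrib)
  qed
  then show ?thesis
    unfolding angular_speed_def using assms
    by (intro bounded_lipschitz_divide[where c = "2 * \<bar>a * b\<bar>"] bounded_lipschitz_diff bounded_lipschitz_add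
        bounded_lipschitz_mult bounded_lipschitz_power bounded_lipschitz_const bounded_lipschitz_minus exp) auto
qed

lemma frame_field_lipschitz:
  assumes "a * b \<noteq> 0"
  shows "\<exists>L. L-lipschitz_on (cball 0 R) (frame_field a b k)"
proof -
  let ?S = "cball (0 :: real \<times> real \<times> real) R"
  have bl: "bounded_lipschitz ?S f" if "bounded_linear f" for f :: "real \<times> real \<times> real \<Rightarrow> real"
  proof -
    interpret bounded_linear f by fact
    have "bounded (f ` ?S)"
      by (intro bounded_linear_image bounded_linear_axioms) auto
    moreover obtain B where "B-lipschitz_on ?S f"
      using lipschitz_boundE by blast
    ultimately show ?thesis
      unfolding bounded_lipschitz_def by blast
  qed
  have z: "bounded_lipschitz ?S (\<lambda>x. fst x)"
    and u: "bounded_lipschitz ?S (\<lambda>x. fst (snd x))"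
    and v: "bounded_lipschitz ?S (\<lambda>x. snd (snd x))"
    by (intro bl bounded_linear_fst bounded_linear_compose[OF bounded_linear_fst bounded_linear_snd]
        bounded_linear_compose[OF bounded_linear_snd bounded_linear_snd])+
  note ang = bounded_lipschitz_angular_speed[OF assms z u v, of k]
  have "\<exists>L. L-lipschitz_on ?S (\<lambda>x. (fst (snd x),
      snd (snd x) * angular_speed a b k (fst x) (fst (snd x)) (snd (snd x)),
      - fst (snd x) * angular_speed a b k (fst x) (fst (snd x)) (snd (snd x))))"
    using u bounded_lipschitz_mult[OF v ang] bounded_lipschitz_mult[OF bounded_lipschitz_minus[OF u] ang]
    by (intro lipschitz_on_Pair_ex) (auto simp: bounded_lipschitz_def)
  then show ?thesis
    by (simp add: frame_field_def case_prod_unfold)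
qed

lemma bounded_lipschitz_clamp:
  "bounded_lipschitz UNIV (\<lambda>x :: real \<times> real. max (- R) (min R (fst x)))"
  unfolding bounded_lipschitz_iff
proof (intro exI conjI ballI)
  fix x y :: "real \<times> real"
  show "\<bar>max (- R) (min R (fst x))\<bar> \<le> \<bar>R\<bar> + 1"
    by (auto simp: max_def min_def)
  have "\<bar>max (- R) (min R (fst x)) - max (- R) (min R (fst y))\<bar> \<le> \<bar>fst x - fst y\<bar>"
    by (auto simp: max_def min_def)
  also have "\<dots> \<le> 1 * dist x y"
    using dist_fst_le[of x y] by (simp add: dist_real_def)
  also have "\<dots> \<le> (\<bar>R\<bar> + 1) * dist x y"
    by (intro mult_right_mono) auto
  finally show "\<bar>max (- R) (min R (fst x)) - max (- R) (min R (fst y))\<bar> \<le> (\<bar>R\<bar> + 1) * dist x y" .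
qed auto

lemma has_vector_derivative_fst_snd:
  assumes "(x has_vector_derivative d) (at s)"
  shows "((\<lambda>s. fst (x s)) has_vector_derivative fst d) (at s)"
    and "((\<lambda>s. snd (x s)) has_vector_derivative snd d) (at s)"
  using bounded_linear.has_vector_derivative[OF bounded_linear_fst assms]
    bounded_linear.has_vector_derivative[OF bounded_linear_snd assms] by auto

text \<open>Polar coordinates \<open>(u, v) = (sin \<theta>, cos \<theta>)\<close> and a truncation of \<open>z\<close> make the system globally
  Lipschitz; as \<open>\<bar>z'\<bar> \<le> 1\<close>, the truncation is not felt up to time \<open>R\<close>.\<close>

lemma frame_field_solution_bounded_time:
  assumes ab: "a * b \<noteq> 0"
  obtains x where "x 0 = (z0, sin \<theta>0, cos \<theta>0)"
    "\<And>s. \<bar>s\<bar> < R \<Longrightarrow> (x has_vector_derivative frame_field a b k (x s)) (at s)"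
    "\<And>s. (fst (snd (x s)))\<^sup>2 + (snd (snd (x s)))\<^sup>2 = 1"
proof -
  define M where "M = \<bar>z0\<bar> + R"
  define clamp where "clamp t = max (- M) (min M t)" for t :: real
  define G where "G p = (sin (snd p), angular_speed a b k (clamp (fst p)) (sin (snd p)) (cos (snd p)))"
    for p :: "real \<times> real"
  have sin: "bounded_lipschitz UNIV (\<lambda>p :: real \<times> real. sin (snd p))"
    and cos: "bounded_lipschitz UNIV (\<lambda>p :: real \<times> real. cos (snd p))"
  proof -
    have 1: "\<bar>sin s - sin t\<bar> \<le> \<bar>s - t\<bar>" "\<bar>cos s - cos t\<bar> \<le> \<bar>s - t\<bar>" for s t :: real
      using field_differentiable_bound[of UNIV sin cos 1 s t]
        field_differentiable_bound[of UNIV cos "\<lambda>t. - sin t" 1 s t]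
      by (auto intro!: derivative_eq_intros)
    have 2: "\<bar>snd p - snd q\<bar> \<le> dist p q" for p q :: "real \<times> real"
      using dist_snd_le[of p q] by (simp add: dist_real_def)
    show "bounded_lipschitz UNIV (\<lambda>p :: real \<times> real. sin (snd p))"
      "bounded_lipschitz UNIV (\<lambda>p :: real \<times> real. cos (snd p))"
      unfolding bounded_lipschitz_iff using order_trans[OF 1(1) 2] order_trans[OF 1(2) 2]
      by (auto intro!: exI[of _ 1])
  qed
  have "\<exists>L. L-lipschitz_on UNIV G"
    unfolding G_def clamp_def
    using sin bounded_lipschitz_angular_speed[OF ab bounded_lipschitz_clamp[of M] sin cos, of k]
    by (intro lipschitz_on_Pair_ex) (auto simp: bounded_lipschitz_def)
  then obtain L where "L-lipschitz_on UNIV G" ..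
  then obtain w where w0: "w 0 = (z0, \<theta>0)" and w: "\<And>s. (w has_vector_derivative G (w s)) (at s)"
    using global_lipschitz_ode_exists by blast
  define Z \<Theta> where "Z s = fst (w s)" and "\<Theta> s = snd (w s)" for s
  have Z: "(Z has_real_derivative sin (\<Theta> s)) (at s)"
    and \<Theta>: "(\<Theta> has_real_derivative angular_speed a b k (clamp (Z s)) (sin (\<Theta> s)) (cos (\<Theta> s))) (at s)" for s
    using has_vector_derivative_fst_snd[OF w[of s]]
    unfolding Z_def[abs_def] \<Theta>_def[abs_def] G_def has_real_derivative_iff_has_vector_derivative by auto
  have clamp: "clamp (Z s) = Z s" if "\<bar>s\<bar> < R" for s
  proof -
    have "norm (Z s - Z 0) \<le> 1 * norm (s - 0)"
      by (rule field_differentiable_bound[of UNIV Z "\<lambda>s. sin (\<Theta> s)"]) (auto intro: Z)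
    moreover have "Z 0 = z0"
      by (simp add: Z_def w0)
    ultimately show ?thesis
      using that by (auto simp: clamp_def M_def)
  qed
  define x where "x s = (Z s, sin (\<Theta> s), cos (\<Theta> s))" for s
  show ?thesis
  proof (rule that[of x])
    show "x 0 = (z0, sin \<theta>0, cos \<theta>0)"
      by (simp add: x_def Z_def \<Theta>_def w0)
    show "(fst (snd (x s)))\<^sup>2 + (snd (snd (x s)))\<^sup>2 = 1" for s
      by (simp add: x_def)
    show "(x has_vector_derivative frame_field a b k (x s)) (at s)" if "\<bar>s\<bar> < R" for s
    proof -
      define A where "A = angular_speed a b k (Z s) (sin (\<Theta> s)) (cos (\<Theta> s))"
      have "(\<Theta> has_real_derivative A) (at s)"
        using \<Theta>[of s] by (simp add: A_def clamp[OF that])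
      from DERIV_chain2[OF DERIV_sin this] DERIV_chain2[OF DERIV_cos this] Z[of s]
      show ?thesis
        unfolding x_def frame_field_def prod.case A_def[symmetric] has_real_derivative_iff_has_vector_derivative
        by (intro has_vector_derivative_Pair) (simp_all add: mult.commute)
    qed
  qed
qed

text \<open>The solutions valid up to time \<open>R\<close> agree on common intervals by uniqueness
  and fuse into one. The system is autonomous, so a time shift moves the initial time to
  \<open>s0\<close>.\<close>

lemma frame_field_solution:
  assumes ab: "a * b \<noteq> 0" and unit: "u0\<^sup>2 + v0\<^sup>2 = 1"
  obtains x where "x s0 = (z0, u0, v0)"
    "\<And>s. (x has_vector_derivative frame_field a b k (x s)) (at s)"
    "\<And>s. (fst (snd (x s)))\<^sup>2 + (snd (snd (x s)))\<^sup>2 = 1"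
proof -
  obtain \<theta>0 where \<theta>0: "u0 = sin \<theta>0" "v0 = cos \<theta>0"
    using sincos_total_2pi[of v0 u0] unit by (metis add.commute)
  have "\<exists>x. x 0 = (z0, u0, v0) \<and>
      (\<forall>s. \<bar>s\<bar> < R \<longrightarrow> (x has_vector_derivative frame_field a b k (x s)) (at s)) \<and>
      (\<forall>s. (fst (snd (x s)))\<^sup>2 + (snd (snd (x s)))\<^sup>2 = 1)" for R
    using frame_field_solution_bounded_time[OF ab, of z0 \<theta>0 R k] unfolding \<theta>0 by metis
  then obtain X where X: "\<And>R. X R 0 = (z0, u0, v0)"
    "\<And>R s. \<bar>s\<bar> < R \<Longrightarrow> (X R has_vector_derivative frame_field a b k (X R s)) (at s)"
    "\<And>R s. (fst (snd (X R s)))\<^sup>2 + (snd (snd (X R s)))\<^sup>2 = 1"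
    by metis
  have agree: "X R s = X R' s" if "\<bar>s\<bar> < R" "\<bar>s\<bar> < R'" for R R' s
    by (rule ode_unique[where H = "frame_field a b k" and J = "{- min R R'<..<min R R'}" and r = 0])
      (use that frame_field_lipschitz[OF ab] X in \<open>auto simp: is_interval_oo\<close>)
  \<comment> \<open>The radius \<open>\<bar>s\<bar> + 1\<close> exceeds
    \<open>\<bar>s\<bar>\<close>; by \<open>agree\<close> any other admissible radius gives the same
    value.\<close>
  define Y where "Y s = X (\<bar>s\<bar> + 1) s" for s
  have Y: "(Y has_vector_derivative frame_field a b k (Y s)) (at s)" for s
  proof -
    define R where "R = \<bar>s\<bar> + 1"
    have eq: "X R t = Y t" if "t \<in> {-R<..<R}" for t
      unfolding Y_def by (rule agree) (use that in auto)
    have s: "s \<in> {-R<..<R}"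
      by (auto simp: R_def)
    have "(X R has_vector_derivative frame_field a b k (X R s)) (at s)"
      by (rule X) (simp add: R_def)
    then have "(X R has_vector_derivative frame_field a b k (Y s)) (at s)"
      by (simp add: eq[OF s])
    then show ?thesis
      by (rule has_vector_derivative_transform_within_open[where S = "{-R<..<R}"]) (use s eq in auto)
  qed
  show ?thesis
  proof (rule that[of "\<lambda>s. Y (s - s0)"])
    show "((\<lambda>s. Y (s - s0)) has_vector_derivative frame_field a b k (Y (s - s0))) (at s)" for s
    proof -
      have "((Y \<circ> (\<lambda>s. s - s0)) has_vector_derivative 1 *\<^sub>R frame_field a b k (Y (s - s0))) (at s)"
        by (intro vector_diff_chain_at Y) (auto intro!: derivative_eq_intros)
      then show ?thesis
        by (simp add: o_def)
    qed
  qed (simp_all add: Y_def X)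
qed

section \<open>Maximal profiles are defined on the whole line\<close>

context framed_profile
begin

lemma unit_deriv:
  assumes "s \<in> I"
  shows "u s * u' s + v s * v' s = 0"
proof -
  have "((\<lambda>s. (u s)\<^sup>2 + (v s)\<^sup>2) has_real_derivative 2 * (u s * u' s + v s * v' s)) (at s)"
    by (auto intro!: derivative_eq_intros du dv assms simp: algebra_simps)
  moreover have "((\<lambda>s. (u s)\<^sup>2 + (v s)\<^sup>2) has_real_derivative 0) (at s)"
    by (rule has_field_derivative_transform_within_open[OF DERIV_const open_I assms]) (simp add: unit)
  ultimately show ?thesis
    using DERIV_unique by fastforce
qed

text \<open>The flow parameter \<open>t\<close> enters the translator equation only through \<open>2 a b c3 t u\<close>.\<close>

lemma translator_eq_imp_c3_eq_0:
  assumes eq: "\<forall>s\<in>I. \<forall>t. translator_eq c1 c2 c3 s t"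
  shows "c3 = 0"
proof (rule ccontr)
  assume c3: "c3 \<noteq> 0"
  have u0: "u s = 0" if "s \<in> I" for s
  proof -
    from eq that have "translator_eq c1 c2 c3 s 0" "translator_eq c1 c2 c3 s 1"
      by blast+
    then have "area_sq s * (u s * (2 * a * b * c3)) = 0"
      unfolding translator_eq_def by (simp add: algebra_simps)
    then show ?thesis
      using area_sq_pos[of s] a b c3 by simp
  qed
  obtain s where s: "s \<in> I"
    using nonempty_I by blast
  \<comment> \<open>With \<open>u\<close> and \<open>u'\<close> zero the curvature side vanishes,
    and the other side is a nonzero multiple of \<open>c3 * v s\<close>. So \<open>v s\<close> would
    vanish together with \<open>u s\<close>, against unit speed.\<close>
  have "(u has_real_derivative 0) (at s)"
    by (rule has_field_derivative_transform_within_open[OF DERIV_const open_I s]) (simp add: u0)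
  then have "u' s = 0"
    using du[OF s] DERIV_unique by blast
  with u0[OF s] eq s have "v s = 0"
    using area_sq_pos[of s] a c3 by (auto simp: translator_eq_def)
  with u0[OF s] unit[OF s] show False
    by simp
qed

lemma translator_eq_iff_angular_speed:
  "translator_eq c1 c2 0 s t \<longleftrightarrow>
    v s * u' s - u s * v' s = angular_speed a b (a * c2 - b * c1) (z s) (u s) (v s)"
proof -
  have cancel: "c * (X - D * w) = Y * (r * k) \<longleftrightarrow> w = (X - k / c * r * Y) / D"
    if "c \<noteq> 0" "D \<noteq> 0" for c D w X Y r k :: real
    using that by (auto simp: field_simps)
  have P: "exp (- z s) = 1 / exp (z s)"
    by (simp add: exp_minus inverse_eq_divide)
  have D: "a\<^sup>2 * (exp (z s))\<^sup>2 + b\<^sup>2 / (exp (z s))\<^sup>2 \<noteq> 0"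
    using a by (intro less_imp_neq[symmetric] add_pos_nonneg) auto
  have c: "a * exp (z s) \<noteq> 0"
    using a by simp
  show ?thesis
    using cancel[OF c D, of "2 * b\<^sup>2 * (u s)\<^sup>2 * v s / (exp (z s))\<^sup>2" "v s * u' s - u s * v' s"
        "area_sq s" "u s" "a * c2 - b * c1"]
    unfolding translator_eq_def angular_speed_def P by (simp add: area_sq_def power_divide)
qed

text \<open>Unit speed gives \<open>u u' + v v' = 0\<close> and the translator equation gives
  \<open>v u' - u v' = w\<close>: a linear system for \<open>(u', v')\<close> with determinant
  \<open>u\<^sup>2 + v\<^sup>2 = 1\<close>.\<close>

lemma frame_field_deriv:
  assumes "\<forall>s\<in>I. \<forall>t. translator_eq c1 c2 0 s t" and s: "s \<in> I"
  shows "((\<lambda>s. (z s, u s, v s)) has_vector_derivative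
    frame_field a b (a * c2 - b * c1) (z s, u s, v s)) (at s)"
proof -
  define w where "w = angular_speed a b (a * c2 - b * c1) (z s) (u s) (v s)"
  have w: "w = v s * u' s - u s * v' s"
    using assms unfolding translator_eq_iff_angular_speed w_def by simp
  have 1: "v s * v' s = - (u s * u' s)"
    using unit_deriv[OF s] by simp
  have "v s * w = (v s)\<^sup>2 * u' s - u s * (v s * v' s)"
    unfolding w by (simp add: algebra_simps power2_eq_square)
  also have "\<dots> = ((u s)\<^sup>2 + (v s)\<^sup>2) * u' s"
    unfolding 1 by (simp add: algebra_simps power2_eq_square)
  finally have u': "u' s = v s * w"
    using unit[OF s] by simp
  have "- u s * w = (u s)\<^sup>2 * v' s - v s * (u s * u' s)"
    unfolding w by (simp add: algebra_simps power2_eq_square)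
  also have "u s * u' s = - (v s * v' s)"
    using 1 by simp
  also have "(u s)\<^sup>2 * v' s - v s * - (v s * v' s) = ((u s)\<^sup>2 + (v s)\<^sup>2) * v' s"
    by (simp add: algebra_simps power2_eq_square)
  finally have v': "v' s = - u s * w"
    using unit[OF s] by simp
  show ?thesis
    using dz[OF s] du[OF s] dv[OF s]
    unfolding frame_field_def prod.case w_def[symmetric] u' v' has_real_derivative_iff_has_vector_derivative
    by (intro has_vector_derivative_Pair)
qed

lemma profile_solution_iff: "profile_solution a b V I \<gamma> \<longleftrightarrow> translator V (strip I) \<Psi>"
proof -
  have "sol_metric (\<gamma> s) (vector_derivative \<gamma> (at s)) (vector_derivative \<gamma> (at s)) = 1" if "s \<in> I" for s
    using unit[OF that]
    by (simp add: sol_metric_exp vector_derivative_\<gamma>[OF that] \<gamma>[OF that])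
      (simp add: field_simps power2_eq_square)
  then show ?thesis
    using open_I interval_I nonempty_I unfolding profile_solution_def by (auto simp: \<gamma>)
qed

end

section \<open>Profile curves and solutions of the system\<close>

text \<open>The frame component is \<open>v = exp (- z) * y'\<close>; the velocity has no
  x-component because the curve stays in the plane \<open>x = 0\<close>. Twice continuous
  differentiability is read off from the surface.\<close>

lemma profile_solution_imp_framed_profile:
  assumes "profile_solution a b V I \<gamma>" and ab: "a * b \<noteq> 0"
  obtains u v u' v' where "framed_profile a b I \<gamma> (\<lambda>s. \<gamma> s $ 2) (\<lambda>s. \<gamma> s $ 3) u v u' v'"
proof -
  define g1 where "g1 s = vector_derivative \<gamma> (at s)" for s
  define g2 where "g2 s = vector_derivative g1 (at s)" for s
  define z where "z s = \<gamma> s $ 3" for s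
  have I: "open I" "is_interval I" "I \<noteq> {}"
    and \<gamma>1: "\<And>s. s \<in> I \<Longrightarrow> \<gamma> s $ 1 = 0"
    and speed: "\<And>s. s \<in> I \<Longrightarrow> sol_metric (\<gamma> s) (g1 s) (g1 s) = 1"
    using assms by (auto simp: profile_solution_def g1_def)
  have "C2_on (strip I) (orbit_surface a b \<gamma>)"
    using assms by (auto simp: profile_solution_def translator_def immersed_surface_def)
  then have "\<And>s. s \<in> I \<Longrightarrow> \<gamma> differentiable (at s)" "continuous_on I g1"
    "\<And>s. s \<in> I \<Longrightarrow> g1 differentiable (at s)" and cg2: "continuous_on I g2"
    unfolding C2_on_orbit_surface g2_def[abs_def] g1_def[abs_def] by blast+
  then have d1: "(\<gamma> has_vector_derivative g1 s) (at s)"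
    and d2: "(g1 has_vector_derivative g2 s) (at s)" if "s \<in> I" for s
    using that by (auto simp: g1_def g2_def vector_derivative_works)
  have c1: "((\<lambda>s. \<gamma> s $ i) has_real_derivative g1 s $ i) (at s)"
    and c2: "((\<lambda>s. g1 s $ i) has_real_derivative g2 s $ i) (at s)" if "s \<in> I" for s i
    using bounded_linear.has_vector_derivative[OF bounded_linear_vec_nth[of i] d1[OF that]]
      bounded_linear.has_vector_derivative[OF bounded_linear_vec_nth[of i] d2[OF that]]
    by (simp_all add: has_real_derivative_iff_has_vector_derivative)
  have g11: "g1 s $ 1 = 0" if "s \<in> I" for s
  proof -
    have "((\<lambda>s. \<gamma> s $ 1) has_real_derivative 0) (at s)"
      by (rule has_field_derivative_transform_within_open[OF DERIV_const I(1) that]) (simp add: \<gamma>1)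
    then show ?thesis
      using c1[OF that] DERIV_unique by blast
  qed
  have dv: "((\<lambda>s. exp (- z s) * g1 s $ 2) has_real_derivative
      exp (- z s) * (g2 s $ 2 - g1 s $ 3 * g1 s $ 2)) (at s)" if "s \<in> I" for s
    using c1[OF that, of 3] unfolding z_def
    by (auto intro!: derivative_eq_intros c2 that simp: algebra_simps)
  have cz: "continuous_on I z" and cg1: "continuous_on I (\<lambda>s. g1 s $ i)" for i
    unfolding z_def using DERIV_isCont[OF c1] DERIV_isCont[OF c2]
    by (simp_all add: continuous_at_imp_continuous_on)
  have "framed_profile a b I \<gamma> (\<lambda>s. \<gamma> s $ 2) z (\<lambda>s. g1 s $ 3) (\<lambda>s. exp (- z s) * g1 s $ 2)
      (\<lambda>s. g2 s $ 3) (\<lambda>s. exp (- z s) * (g2 s $ 2 - g1 s $ 3 * g1 s $ 2))"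
  proof
    show "a * b \<noteq> 0" "open I" "is_interval I" "I \<noteq> {}"
      by fact+
    show "\<gamma> s = vector [0, \<gamma> s $ 2, z s]" if "s \<in> I" for s
      using \<gamma>1[OF that] by (simp add: vec_eq_iff forall_3 z_def)
    show "((\<lambda>s. \<gamma> s $ 2) has_real_derivative exp (z s) * (exp (- z s) * g1 s $ 2)) (at s)"
      if "s \<in> I" for s
      using c1[OF that, of 2] by (simp add: mult.assoc[symmetric] flip: exp_add)
    show "(z has_real_derivative g1 s $ 3) (at s)" if "s \<in> I" for s
      using c1[OF that] by (simp add: z_def[abs_def])
    show "((\<lambda>s. g1 s $ 3) has_real_derivative g2 s $ 3) (at s)" if "s \<in> I" for s
      using c2[OF that] .
    show "((\<lambda>s. exp (- z s) * g1 s $ 2) has_real_derivative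
      exp (- z s) * (g2 s $ 2 - g1 s $ 3 * g1 s $ 2)) (at s)" if "s \<in> I" for s
      using dv[OF that] .
    show "continuous_on I (\<lambda>s. g2 s $ 3)"
      "continuous_on I (\<lambda>s. exp (- z s) * (g2 s $ 2 - g1 s $ 3 * g1 s $ 2))"
      by (intro continuous_intros cz cg1 cg2)+
    show "(g1 s $ 3)\<^sup>2 + (exp (- z s) * g1 s $ 2)\<^sup>2 = 1" if "s \<in> I" for s
      using speed[OF that] g11[OF that]
      by (simp add: sol_metric_exp z_def exp_minus power_mult_distrib)
        (simp add: field_simps power2_eq_square)
  qed
  then show thesis
    using that unfolding z_def[abs_def] by blast
qed

lemma framed_profile_of_solution:
  assumes ab: "a * b \<noteq> 0"
    and x: "\<And>s. ((\<lambda>s. (z s, u s, v s)) has_vector_derivative frame_field a b k (z s, u s, v s)) (at s)"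
    and unit: "\<And>s. (u s)\<^sup>2 + (v s)\<^sup>2 = 1"
    and y: "\<And>s. (y has_real_derivative exp (z s) * v s) (at s)"
  shows "framed_profile a b UNIV (\<lambda>s. vector [0, y s, z s]) y z u v
    (\<lambda>s. v s * angular_speed a b k (z s) (u s) (v s)) (\<lambda>s. - u s * angular_speed a b k (z s) (u s) (v s))"
proof -
  have z: "(z has_real_derivative u s) (at s)"
    and u: "(u has_real_derivative v s * angular_speed a b k (z s) (u s) (v s)) (at s)"
    and v: "(v has_real_derivative - u s * angular_speed a b k (z s) (u s) (v s)) (at s)" for s
    using has_vector_derivative_fst_snd(1)[OF x[of s]]
      has_vector_derivative_fst_snd(1)[OF has_vector_derivative_fst_snd(2)[OF x[of s]]]
      has_vector_derivative_fst_snd(2)[OF has_vector_derivative_fst_snd(2)[OF x[of s]]]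
    by (simp_all add: frame_field_def has_real_derivative_iff_has_vector_derivative)
  have c: "continuous_on UNIV z" "continuous_on UNIV u" "continuous_on UNIV v"
    using DERIV_isCont[OF z] DERIV_isCont[OF u] DERIV_isCont[OF v]
    by (simp_all add: continuous_at_imp_continuous_on)
  have D: "a\<^sup>2 * (exp t)\<^sup>2 + b\<^sup>2 * (exp (- t))\<^sup>2 \<noteq> 0" for t
    using ab by (intro less_imp_neq[symmetric] add_pos_nonneg) auto
  have "continuous_on UNIV (\<lambda>s. angular_speed a b k (z s) (u s) (v s))"
    unfolding angular_speed_def by (intro continuous_intros c) (simp add: D)
  then show ?thesis
    using ab by unfold_locales (auto intro!: continuous_intros y z u v[simplified] c simp: unit)
qed

text \<open>The global solution of the system through the state at one time \<open>s0\<close> yields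
  a profile on the whole line that extends \<open>\<gamma>\<close>, so maximality leaves no
  room.\<close>

lemma maximal_profile_global:
  assumes V: "\<And>q. V q = c1 *\<^sub>R F1 q + c2 *\<^sub>R F2 q + c3 *\<^sub>R F3 q"
    and max: "maximal_profile a b V I \<gamma>" and ab: "a * b \<noteq> 0"
  obtains y z u v u' v' k where "I = UNIV" "c3 = 0"
    "framed_profile a b UNIV \<gamma> y z u v u' v'"
    "\<And>s. ((\<lambda>s. (z s, u s, v s)) has_vector_derivative frame_field a b k (z s, u s, v s)) (at s)"
proof -
  define k where "k = a * c2 - b * c1"
  have sol: "profile_solution a b V I \<gamma>"
    using max by (simp add: maximal_profile_def)
  define y z where "y s = \<gamma> s $ 2" and "z s = \<gamma> s $ 3" for s
  obtain u v u' v' where fr: "framed_profile a b I \<gamma> y z u v u' v'"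
    using profile_solution_imp_framed_profile[OF sol ab] unfolding y_def[abs_def] z_def[abs_def] by blast
  interpret p: framed_profile a b I \<gamma> y z u v u' v'
    by (rule fr)
  have "translator V (strip I) p.\<Psi>"
    using sol p.profile_solution_iff by blast
  then have eq: "\<forall>s\<in>I. \<forall>t. p.translator_eq c1 c2 c3 s t"
    unfolding p.translator_iff[OF V] .
  have c3: "c3 = 0"
    using p.translator_eq_imp_c3_eq_0[OF eq] .
  obtain s0 where s0: "s0 \<in> I"
    using p.nonempty_I by blast
  obtain x where x0: "x s0 = (z s0, u s0, v s0)"
    and x: "\<And>s. (x has_vector_derivative frame_field a b k (x s)) (at s)"
    and x_unit: "\<And>s. (fst (snd (x s)))\<^sup>2 + (snd (snd (x s)))\<^sup>2 = 1"
    using frame_field_solution[OF ab p.unit[OF s0], of s0 "z s0" k] by blast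
  define Z U W where "Z s = fst (x s)" and "U s = fst (snd (x s))" and "W s = snd (snd (x s))" for s
  have x_eq: "x = (\<lambda>s. (Z s, U s, W s))"
    by (simp add: Z_def U_def W_def)
  have agree: "x s = (z s, u s, v s)" if "s \<in> I" for s
    by (rule ode_unique[where H = "frame_field a b k" and J = I and r = s0])
      (use that frame_field_lipschitz[OF ab] x p.frame_field_deriv[OF eq[unfolded c3]] s0 x0 p.interval_I
        in \<open>simp_all add: k_def\<close>)
  define g where "g s = exp (Z s) * W s" for s
  have "continuous_on UNIV x"
    using has_vector_derivative_continuous[OF x] by (simp add: continuous_at_imp_continuous_on)
  then have "continuous_on UNIV g"
    unfolding g_def Z_def W_def by (intro continuous_intros)
  then have prim: "(prim g has_real_derivative g s) (at s)" for s
    using has_vector_derivative_prim by (simp add: has_real_derivative_iff_has_vector_derivative)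
  \<comment> \<open>The system does not involve \<open>y\<close>; it is recovered by integrating
    \<open>exp Z * W\<close>, with the constant fitted at \<open>s0\<close>.\<close>
  define Y where "Y s = y s0 + (prim g s - prim g s0)" for s
  have Y: "(Y has_real_derivative exp (Z s) * W s) (at s)" for s
    using prim unfolding Y_def by (auto intro!: derivative_eq_intros simp: g_def)
  define \<delta> where "\<delta> s = (vector [0, Y s, Z s] :: real^3)" for s
  interpret q: framed_profile a b UNIV \<delta> Y Z U W "\<lambda>s. W s * angular_speed a b k (Z s) (U s) (W s)"
    "\<lambda>s. - U s * angular_speed a b k (Z s) (U s) (W s)"
    unfolding \<delta>_def
    by (rule framed_profile_of_solution[OF ab])
      (use x x_unit Y in \<open>simp_all add: x_eq\<close>)
  have "q.translator_eq c1 c2 c3 s t" for s t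
  proof -
    have "W s * (W s * A) - U s * (- U s * A) = ((U s)\<^sup>2 + (W s)\<^sup>2) * A" for A
      by (simp add: algebra_simps power2_eq_square)
    then have "W s * (W s * A) - U s * (- U s * A) = A" for A
      by (simp only: q.unit[OF UNIV_I] mult_1)
    then show ?thesis
      unfolding c3 q.translator_eq_iff_angular_speed k_def[symmetric] .
  qed
  then have "translator V (strip UNIV) q.\<Psi>"
    unfolding q.translator_iff[OF V] by blast
  then have \<delta>: "profile_solution a b V UNIV \<delta>"
    using q.profile_solution_iff by blast
  have zuv: "Z s = z s" "U s = u s" "W s = v s" if "s \<in> I" for s
    using agree[OF that] by (simp_all add: Z_def U_def W_def)
  have "Y s - y s = Y s0 - y s0" if s: "s \<in> I" for s
  proof -
    have "norm ((Y s - y s) - (Y s0 - y s0)) \<le> 0 * norm (s - s0)"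
    proof (rule field_differentiable_bound[of I "\<lambda>s. Y s - y s" "\<lambda>s. 0"])
      fix t assume t: "t \<in> I"
      have "((\<lambda>s. Y s - y s) has_real_derivative exp (Z t) * W t - exp (z t) * v t) (at t)"
        by (intro DERIV_diff Y p.dy t)
      then show "((\<lambda>s. Y s - y s) has_real_derivative 0) (at t within I)"
        using zuv[OF t] by (auto intro: DERIV_subset)
    qed (use s s0 p.interval_I in \<open>auto simp: is_interval_convex_1\<close>)
    then show ?thesis by simp
  qed
  then have "\<delta> s = \<gamma> s" if "s \<in> I" for s
    using that zuv[OF that] by (simp add: \<delta>_def p.\<gamma> Y_def)
  then have I: "UNIV = I"
    using max \<delta> unfolding maximal_profile_def by blast
  show thesis
  proof (rule that)
    show "I = UNIV" "c3 = 0"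
      using I c3 by simp_all
    show "framed_profile a b UNIV \<gamma> y z u v u' v'"
      using fr I by simp
    show "((\<lambda>s. (z s, u s, v s)) has_vector_derivative frame_field a b k (z s, u s, v s)) (at s)" for s
      using p.frame_field_deriv[OF eq[unfolded c3]] I by (auto simp: k_def)
  qed
qed

section \<open>Lengths of paths on a transversal surface\<close>

text \<open>For the gauge integral the fundamental theorem tolerates finitely many exceptional
  points and needs no bound on \<open>h'\<close> near them; continuity of \<open>h\<close> bridges
  the break points of a piecewise path.\<close>

lemma variation_le_integral:
  fixes h :: "real \<Rightarrow> real"
  assumes h: "continuous_on {0..1} h" and K: "finite K"
    and h': "\<And>x. x \<in> {0<..<1} - K \<Longrightarrow> (h has_real_derivative h' x) (at x)"
    and le: "\<And>x. x \<in> {0<..<1} - K \<Longrightarrow> \<bar>h' x\<bar> \<le> C * f x"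
    and f: "f integrable_on {0..1}" "\<And>x. 0 \<le> f x" and C: "0 \<le> C" and t: "t \<in> {0..1}"
  shows "\<bar>h t - h 0\<bar> \<le> C * integral {0..1} f"
proof -
  \<comment> \<open>At the break points and at the ends nothing is known about \<open>h'\<close>;
    setting it to 0 there keeps the integral and makes \<open>\<bar>g x\<bar> \<le> C * f x\<close>
    hold everywhere.\<close>
  define g where "g x = (if x \<in> K \<union> {0, t} then 0 else h' x)" for x
  have sub: "{0..t} \<subseteq> {0..1}"
    using t by auto
  have "(h' has_integral h t - h 0) {0..t}"
    using t continuous_on_subset[OF h sub]
    by (intro fundamental_theorem_of_calculus_interior_strong[OF K])
      (auto simp: h' has_real_derivative_iff_has_vector_derivative[symmetric])
  then have g: "(g has_integral h t - h 0) {0..t}"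
    by (rule has_integral_spike_finite[where S = "K \<union> {0, t}", rotated -1]) (use K in \<open>auto simp: g_def\<close>)
  have ft: "f integrable_on {0..t}"
    using integrable_on_subinterval[OF f(1) sub] .
  have "norm (integral {0..t} g) \<le> integral {0..t} (\<lambda>x. C * f x)"
  proof (rule integral_norm_bound_integral)
    show "g integrable_on {0..t}"
      using g by blast
    show "(\<lambda>x. C * f x) integrable_on {0..t}"
      using ft by (rule integrable_on_mult_right)
    show "norm (g x) \<le> C * f x" if "x \<in> {0..t}" for x
      using that t le[of x] f(2)[of x] C by (auto simp: g_def)
  qed
  also have "\<dots> = C * integral {0..t} f"
    by simp
  also have "\<dots> \<le> C * integral {0..1} f"
    using C f ft sub by (intro mult_left_mono integral_subset_le) auto
  finally show ?thesis
    using integral_unique[OF g] by simp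
qed

lemma sol_metric_nonneg: "0 \<le> sol_metric p w w"
  by (auto simp: sol_metric_exp intro!: add_nonneg_nonneg)
    (simp_all add: mult.assoc)

lemma component_le_speed:
  fixes c :: "real \<Rightarrow> real^3" and s :: real
  defines "w \<equiv> vector_derivative c (at s)"
  shows "exp (c s $ 3) * \<bar>w $ 1\<bar> \<le> speed c s" "\<bar>w $ 2\<bar> / exp (c s $ 3) \<le> speed c s"
    "\<bar>w $ 3\<bar> \<le> speed c s"
proof -
  have sq: "sol_metric (c s) w w = (exp (c s $ 3) * \<bar>w $ 1\<bar>)\<^sup>2 + (\<bar>w $ 2\<bar> / exp (c s $ 3))\<^sup>2 + \<bar>w $ 3\<bar>\<^sup>2"
    by (simp add: sol_metric_exp power_mult_distrib power_divide) (simp add: power2_eq_square)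
  show "exp (c s $ 3) * \<bar>w $ 1\<bar> \<le> speed c s" "\<bar>w $ 2\<bar> / exp (c s $ 3) \<le> speed c s"
    "\<bar>w $ 3\<bar> \<le> speed c s"
    unfolding speed_def w_def[symmetric] sq by (intro real_le_rsqrt; simp)+
qed

lemma speed_nonneg: "0 \<le> speed c s"
  by (simp add: speed_def sol_metric_nonneg)

lemma induced_dist_nonneg: "0 \<le> induced_dist M p q"
  unfolding induced_dist_def connecting_paths_def
  by (auto intro!: INF_greatest integral_nonneg simp: speed_nonneg)

lemma connecting_pathsD:
  assumes "c \<in> connecting_paths M p q"
  shows "continuous_on {0..1} c" "c 0 = p" "c 1 = q" "speed c integrable_on {0..1}"
    and "\<And>t. t \<in> {0..1} \<Longrightarrow> c t \<in> M"
    and "\<exists>K. finite K \<and> (\<forall>t\<in>{0<..<1} - K. (c has_vector_derivative vector_derivative c (at t)) (at t))"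
proof -
  have c: "c piecewise_C1_differentiable_on {0..1}" "speed c integrable_on {0..1}" "path_image c \<subseteq> M"
    "c 0 = p" "c 1 = q"
    using assms by (auto simp: connecting_paths_def valid_path_def pathstart_def pathfinish_def)
  then obtain K where K: "finite K" "c C1_differentiable_on {0..1} - K" "continuous_on {0..1} c"
    unfolding piecewise_C1_differentiable_on_def by blast
  show "continuous_on {0..1} c" "c 0 = p" "c 1 = q" "speed c integrable_on {0..1}"
    by fact+
  show "c t \<in> M" if "t \<in> {0..1}" for t
    using c(3) that by (auto simp: path_image_def image_subset_iff)
  have "c differentiable (at t)" if "t \<in> {0<..<1} - K" for t
    using K(2) that unfolding C1_differentiable_on_eq by auto
  with K(1) show "\<exists>K. finite K \<and> (\<forall>t\<in>{0<..<1} - K. (c has_vector_derivative vector_derivative c (at t)) (at t))"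
    unfolding vector_derivative_works by blast
qed

lemma connecting_path_height_le:
  assumes "c \<in> connecting_paths M p q" and t: "t \<in> {0..1}"
  shows "\<bar>c t $ 3 - p $ 3\<bar> \<le> integral {0..1} (speed c)"
proof -
  note c = connecting_pathsD[OF assms(1)]
  obtain K where K: "finite K"
    "\<And>t. t \<in> {0<..<1} - K \<Longrightarrow> (c has_vector_derivative vector_derivative c (at t)) (at t)"
    using c(6) by blast
  have "\<bar>c t $ 3 - c 0 $ 3\<bar> \<le> 1 * integral {0..1} (speed c)"
  proof (rule variation_le_integral[OF _ K(1) _ _ c(4) speed_nonneg _ t])
    show "((\<lambda>t. c t $ 3) has_real_derivative vector_derivative c (at x) $ 3) (at x)"
      if "x \<in> {0<..<1} - K" for x
      using bounded_linear.has_vector_derivative[OF bounded_linear_vec_nth K(2)[OF that]]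
      by (simp add: has_real_derivative_iff_has_vector_derivative)
  qed (use c(1) component_le_speed(3)[of c] in \<open>auto intro!: continuous_intros\<close>)
  then show ?thesis
    by (simp add: c(2))
qed

lemma connecting_path_x_le:
  assumes "c \<in> connecting_paths M p q" and R: "\<And>t. t \<in> {0..1} \<Longrightarrow> \<bar>c t $ 3\<bar> \<le> R"
  shows "\<bar>q $ 1 - p $ 1\<bar> \<le> exp R * integral {0..1} (speed c)"
proof -
  note c = connecting_pathsD[OF assms(1)]
  obtain K where K: "finite K"
    "\<And>t. t \<in> {0<..<1} - K \<Longrightarrow> (c has_vector_derivative vector_derivative c (at t)) (at t)"
    using c(6) by blast
  have "\<bar>c 1 $ 1 - c 0 $ 1\<bar> \<le> exp R * integral {0..1} (speed c)"
  proof (rule variation_le_integral[OF _ K(1) _ _ c(4) speed_nonneg])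
    fix x assume x: "x \<in> {0<..<1} - K"
    show "((\<lambda>t. c t $ 1) has_real_derivative vector_derivative c (at x) $ 1) (at x)"
      using bounded_linear.has_vector_derivative[OF bounded_linear_vec_nth K(2)[OF x]]
      by (simp add: has_real_derivative_iff_has_vector_derivative)
    have "1 \<le> exp R * exp (c x $ 3)"
      using R[of x] x by (simp flip: exp_add)
    then have "\<bar>vector_derivative c (at x) $ 1\<bar> \<le>
        (exp R * exp (c x $ 3)) * \<bar>vector_derivative c (at x) $ 1\<bar>"
      by (simp add: mult_le_cancel_right1)
    also have "\<dots> \<le> exp R * speed c x"
      using component_le_speed(1)[of c x] by (simp add: mult.assoc)
    finally show "\<bar>vector_derivative c (at x) $ 1\<bar> \<le> exp R * speed c x" .
  qed (use c(1) in \<open>auto intro!: continuous_intros\<close>)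
  then show ?thesis
    by (simp add: c(2,3))
qed

section \<open>Surfaces over profiles with strictly monotone height\<close>

locale transversal_profile = framed_profile a b UNIV \<gamma> y z u v u' v'
  for a b \<gamma> y z u v u' v' +
  assumes u_nonzero: "u s \<noteq> 0"
begin

definition M :: "(real^3) set" where "M = \<Psi> ` strip UNIV"

text \<open>The profile parameter as a function of the height, meaningful on
  \<open>range z\<close>.\<close>

definition height_inv :: "real \<Rightarrow> real" where "height_inv = inv z"

lemma \<Psi>_eq': "\<Psi> p = vector [a * p$2, y (p$1) + b * p$2, z (p$1)]"
  by (simp add: \<Psi>_eq)

lemma inj_z: "inj z"
proof (rule injI, rule ccontr)
  fix s t assume eq: "z s = z t" and "s \<noteq> t"
  then consider "s < t" | "t < s" by linarith
  then show False
  proof cases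
    case 1
    from MVT2[OF this, of z u] dz eq u_nonzero 1 show False by auto
  next
    case 2
    from MVT2[OF this, of z u] dz eq u_nonzero 2 show False by auto
  qed
qed

lemma height_inv_z [simp]: "height_inv (z s) = s"
  by (simp add: height_inv_def inj_z)

lemma height_inv_deriv: "(height_inv has_real_derivative 1 / u s) (at (z s))"
proof -
  have "(height_inv has_derivative (\<lambda>h. h / u s)) (at (z s))"
  proof (rule has_derivative_inverse_strong[of UNIV s z height_inv "\<lambda>h. u s * h"])
    show "(z has_derivative (*) (u s)) (at s)"
      using dz[of s] by (simp add: has_field_derivative_def)
    show "(*) (u s) \<circ> (\<lambda>h. h / u s) = id"
      using u_nonzero by (auto simp: fun_eq_iff)
  qed (use continuous_on_derivs in auto)
  then show ?thesis
    unfolding has_field_derivative_def by (rule has_derivative_eq_rhs) auto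
qed

lemma open_range_z: "open (range z)"
  using injective_eq_1d_open_map_UNIV[of UNIV z] inj_z continuous_on_derivs(2) by auto

text \<open>Since \<open>a \<noteq> 0\<close>, the flow time is \<open>p $ 1 / a\<close> and can be
  eliminated.\<close>

lemma in_M_iff: "p \<in> M \<longleftrightarrow> (\<exists>s. p $ 3 = z s \<and> p $ 2 = y s + b / a * p $ 1)"
proof
  assume "p \<in> M"
  then obtain q :: "real^2" where "p = vector [a * q$2, y (q$1) + b * q$2, z (q$1)]"
    by (auto simp: M_def \<Psi>_eq')
  then show "\<exists>s. p $ 3 = z s \<and> p $ 2 = y s + b / a * p $ 1"
    using a by (intro exI[of _ "q$1"]) simp
next
  assume "\<exists>s. p $ 3 = z s \<and> p $ 2 = y s + b / a * p $ 1"
  then obtain s where s: "p $ 3 = z s" "p $ 2 = y s + b / a * p $ 1" by blast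
  have "p = \<Psi> (vector [s, p $ 1 / a])"
    using a s by (simp add: \<Psi>_eq' vec_eq_iff forall_3)
  then show "p \<in> M"
    unfolding M_def strip_def by blast
qed

lemma in_M:
  assumes "p \<in> M"
  shows "p $ 3 = z (height_inv (p $ 3))" "p $ 2 = y (height_inv (p $ 3)) + b / a * p $ 1"
  using assms by (auto simp: in_M_iff)

text \<open>For lack of a lower bound on \<open>\<bar>u\<bar>\<close> the estimate goes through
  \<open>\<bar>h'\<bar> \<le> \<bar>u h'\<bar> + \<bar>v h'\<bar>\<close>. The first summand is the
  vertical velocity, the second the y-velocity freed from the flow. The x- and y-velocities each
  cost at most one factor \<open>exp R\<close>, whence \<open>exp (2 * R)\<close>.\<close>

lemma connecting_path_parameter_le:
  assumes "c \<in> connecting_paths M p q" and R: "\<And>t. t \<in> {0..1} \<Longrightarrow> \<bar>c t $ 3\<bar> \<le> R"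
  shows "\<bar>height_inv (q $ 3) - height_inv (p $ 3)\<bar> \<le> (2 + \<bar>b / a\<bar> * exp (2 * R)) * integral {0..1} (speed c)"
proof -
  note c = connecting_pathsD[OF assms(1)]
  obtain K where K: "finite K"
    "\<And>t. t \<in> {0<..<1} - K \<Longrightarrow> (c has_vector_derivative vector_derivative c (at t)) (at t)"
    using c(6) by blast
  define h where "h t = height_inv (c t $ 3)" for t
  have h: "c t $ 3 = z (h t)" "c t $ 2 = y (h t) + b / a * c t $ 1" if "t \<in> {0..1}" for t
    using in_M[OF c(5)[OF that]] by (simp_all add: h_def)
  have "\<bar>h 1 - h 0\<bar> \<le> (2 + \<bar>b / a\<bar> * exp (2 * R)) * integral {0..1} (speed c)"
  proof (rule variation_le_integral[OF _ K(1) _ _ c(4) speed_nonneg])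
    show "continuous_on {0..1} h"
      unfolding h_def
    proof (rule continuous_on_compose2[of "range z" height_inv])
      show "continuous_on (range z) height_inv"
        using DERIV_isCont[OF height_inv_deriv] by (auto intro: continuous_at_imp_continuous_on)
      show "(\<lambda>t. c t $ 3) ` {0..1} \<subseteq> range z"
        using h(1) by auto
    qed (intro continuous_intros c(1))
    fix x assume x: "x \<in> {0<..<1} - K"
    then have x01: "x \<in> {0..1}" by auto
    define w where "w = vector_derivative c (at x)"
    have dc: "((\<lambda>t. c t $ i) has_real_derivative w $ i) (at x)" for i
      using bounded_linear.has_vector_derivative[OF bounded_linear_vec_nth K(2)[OF x]]
      by (simp add: has_real_derivative_iff_has_vector_derivative w_def)
    define h' where "h' = w $ 3 / u (h x)"
    have dh: "(h has_real_derivative h') (at x)"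
    proof -
      have "(height_inv has_real_derivative 1 / u (h x)) (at (c x $ 3))"
        using height_inv_deriv[of "h x"] by (simp flip: h(1)[OF x01])
      from DERIV_chain2[OF this dc] show ?thesis
        unfolding h_def[abs_def] h'_def by simp
    qed
    then show "(h has_real_derivative vector_derivative c (at x) $ 3 / u (h x)) (at x)"
      by (simp add: h'_def w_def)
    have "((\<lambda>t. y (h t) + b / a * c t $ 1) has_real_derivative
        (exp (z (h x)) * v (h x)) * h' + b / a * w $ 1) (at x)"
      by (intro DERIV_add DERIV_cmult DERIV_chain2[OF dy dh] dc) simp
    moreover have "((\<lambda>t. y (h t) + b / a * c t $ 1) has_real_derivative w $ 2) (at x)"
      by (rule has_field_derivative_transform_within_open[OF dc, of "{0<..<1}"])
        (use x h(2) in auto)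
    \<comment> \<open>Differentiating the equation of the surface along the path expresses
      \<open>v h'\<close> through the velocity of the path.\<close>
    ultimately have w2: "w $ 2 = exp (z (h x)) * (v (h x) * h') + b / a * w $ 1"
      using DERIV_unique by (fastforce simp: mult.assoc)
    have w3: "w $ 3 = u (h x) * h'"
      using u_nonzero by (simp add: h'_def)
    define P where "P = exp (z (h x))"
    have P: "0 < P" "exp (c x $ 3) = P"
      by (simp_all add: P_def h(1)[OF x01])
    have comp: "P * \<bar>w $ 1\<bar> \<le> speed c x" "\<bar>w $ 2\<bar> / P \<le> speed c x" "\<bar>w $ 3\<bar> \<le> speed c x"
      using component_le_speed[of c x] by (simp_all add: w_def P)
    have "(h')\<^sup>2 = ((u (h x))\<^sup>2 + (v (h x))\<^sup>2) * (h')\<^sup>2"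
      by (simp add: unit)
    also have "\<dots> = (u (h x) * h')\<^sup>2 + (v (h x) * h')\<^sup>2"
      by (simp add: algebra_simps power_mult_distrib)
    also have "\<dots> \<le> (\<bar>u (h x) * h'\<bar> + \<bar>v (h x) * h'\<bar>)\<^sup>2"
      unfolding power2_sum by (simp add: power2_abs)
    finally have "\<bar>h'\<bar> \<le> \<bar>\<bar>u (h x) * h'\<bar> + \<bar>v (h x) * h'\<bar>\<bar>"
      by (simp only: abs_le_square_iff)
    also have "\<dots> = \<bar>u (h x) * h'\<bar> + \<bar>v (h x) * h'\<bar>"
      by (rule abs_of_nonneg) simp
    also have "\<bar>u (h x) * h'\<bar> \<le> speed c x"
      using comp(3) by (simp add: w3)
    also have "\<bar>v (h x) * h'\<bar> \<le> (1 + \<bar>b / a\<bar> * exp (2 * R)) * speed c x"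
    proof -
      have "v (h x) * h' = w $ 2 / P - b / a * w $ 1 / P"
        using P(1) by (simp add: w2 field_simps flip: P_def)
      then have "\<bar>v (h x) * h'\<bar> \<le> \<bar>w $ 2 / P\<bar> + \<bar>b / a * w $ 1 / P\<bar>"
        by (simp only: abs_triangle_ineq4)
      also have "\<dots> = \<bar>w $ 2\<bar> / P + \<bar>b / a\<bar> * ((1 / P\<^sup>2) * (P * \<bar>w $ 1\<bar>))"
        using P(1) by (simp add: abs_mult field_simps power2_eq_square)
      also have "\<dots> \<le> speed c x + \<bar>b / a\<bar> * (exp (2 * R) * speed c x)"
      proof (intro add_mono mult_left_mono mult_mono comp)
        have "1 / P\<^sup>2 = exp (- (2 * c x $ 3))"
          by (simp add: exp_minus exp_double P inverse_eq_divide)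
        also have "\<dots> \<le> exp (2 * R)"
          using R[OF x01] by simp
        finally show "1 / P\<^sup>2 \<le> exp (2 * R)" .
      qed (use P in auto)
      finally show ?thesis
        by (simp add: algebra_simps)
    qed
    finally show "\<bar>vector_derivative c (at x) $ 3 / u (h x)\<bar> \<le> (2 + \<bar>b / a\<bar> * exp (2 * R)) * speed c x"
      by (simp add: h'_def w_def algebra_simps)
  qed auto
  then show ?thesis
    by (simp add: h_def c(2,3))
qed

text \<open>The competing path is the image of the straight parameter segment: motion along the
  profile has unit speed, and the flow has speed at most
  \<open>(\<bar>a\<bar> + \<bar>b\<bar>) * exp R\<close> at heights up to \<open>R\<close>.\<close>

lemma induced_dist_le:
  assumes R: "\<And>s. s \<in> closed_segment (p $ 1) (q $ 1) \<Longrightarrow> \<bar>z s\<bar> \<le> R"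
  shows "induced_dist M (\<Psi> p) (\<Psi> q) \<le>
    ereal (\<bar>q $ 1 - p $ 1\<bar> + (\<bar>a\<bar> + \<bar>b\<bar>) * exp R * \<bar>q $ 2 - p $ 2\<bar>)"
proof -
  define ds dt where "ds = q $ 1 - p $ 1" and "dt = q $ 2 - p $ 2"
  define \<sigma> where "\<sigma> r = p $ 1 + r * ds" for r
  define c where "c r = (vector [a * (p $ 2 + r * dt), y (\<sigma> r) + b * (p $ 2 + r * dt), z (\<sigma> r)] :: real^3)" for r
  define c' where "c' r = (vector [a * dt, exp (z (\<sigma> r)) * v (\<sigma> r) * ds + b * dt, u (\<sigma> r) * ds] :: real^3)" for r
  define L where "L = \<bar>ds\<bar> + (\<bar>a\<bar> + \<bar>b\<bar>) * exp R * \<bar>dt\<bar>"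
  have d\<sigma>: "(\<sigma> has_real_derivative ds) (at r)" for r
    unfolding \<sigma>_def by (auto intro!: derivative_eq_intros)
  have dc: "(c has_vector_derivative c' r) (at r)" for r
    unfolding c_def c'_def
    by (intro has_vector_derivative_vector_3 DERIV_add DERIV_chain2[OF dy d\<sigma>] DERIV_chain2[OF dz d\<sigma>])
      (auto intro!: derivative_eq_intros)
  have cont: "continuous_on A \<sigma>" "continuous_on A (\<lambda>r. z (\<sigma> r))" "continuous_on A (\<lambda>r. u (\<sigma> r))"
    "continuous_on A (\<lambda>r. v (\<sigma> r))" for A
  proof -
    show \<sigma>: "continuous_on A \<sigma>"
      unfolding \<sigma>_def by (intro continuous_intros)
    show "continuous_on A (\<lambda>r. z (\<sigma> r))" "continuous_on A (\<lambda>r. u (\<sigma> r))" "continuous_on A (\<lambda>r. v (\<sigma> r))"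
      by (rule continuous_on_compose2[OF _ \<sigma>], rule continuous_on_derivs, simp)+
  qed
  have cc: "continuous_on A c" for A
    using has_vector_derivative_continuous[OF dc] by (simp add: continuous_at_imp_continuous_on)
  have cc': "continuous_on A c'" for A
    unfolding c'_def vector_3_axis by (intro continuous_intros cont)
  have speed: "speed c r = sqrt (sol_metric (c r) (c' r) (c' r))" for r
    by (simp add: speed_def vector_derivative_at[OF dc])
  have int: "speed c integrable_on {0..1}"
    unfolding speed[abs_def] sol_metric_exp
    by (intro integrable_continuous_real continuous_intros)
      (auto intro!: cc cc' exp_not_eq_zero)
  have speed_le: "speed c r \<le> L" if r: "r \<in> {0..1}" for r
  proof -
    define P where "P = exp (z (\<sigma> r))"
    \<comment> \<open>The lengths of the x- and y-parts of the flow velocity. Only the y-part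
      interacts with the profile velocity, which has no x-component.\<close>
    define A B where "A = P * \<bar>a\<bar> * \<bar>dt\<bar>" and "B = \<bar>b\<bar> / P * \<bar>dt\<bar>"
    have P: "0 < P" by (simp add: P_def)
    have "\<sigma> r \<in> closed_segment (p $ 1) (q $ 1)"
      using r unfolding closed_segment_def by (auto simp: \<sigma>_def ds_def algebra_simps intro!: exI[of _ r])
    then have z: "\<bar>z (\<sigma> r)\<bar> \<le> R" by (rule R)
    then have "P \<le> exp R" "1 / P \<le> exp R"
      by (auto simp: P_def exp_minus inverse_eq_divide[symmetric] simp flip: exp_minus)
    then have AB: "A + B \<le> (\<bar>a\<bar> + \<bar>b\<bar>) * exp R * \<bar>dt\<bar>"
    proof -
      have "A \<le> exp R * \<bar>a\<bar> * \<bar>dt\<bar>"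
        unfolding A_def using \<open>P \<le> exp R\<close> by (intro mult_right_mono) auto
      moreover have "B \<le> (exp R * \<bar>b\<bar>) * \<bar>dt\<bar>"
        unfolding B_def using mult_right_mono[OF \<open>1 / P \<le> exp R\<close>, of "\<bar>b\<bar>"]
        by (intro mult_right_mono) auto
      ultimately show ?thesis by (simp add: algebra_simps)
    qed
    have v1: "\<bar>v (\<sigma> r)\<bar> \<le> 1"
    proof -
      have "(v (\<sigma> r))\<^sup>2 \<le> 1"
        using unit[of "\<sigma> r", OF UNIV_I] zero_le_power2[of "u (\<sigma> r)"] by linarith
      then show ?thesis
        by (simp only: abs_square_le_1)
    qed
    have "sol_metric (c r) (c' r) (c' r) =
        (P * a * dt)\<^sup>2 + (v (\<sigma> r) * ds + b / P * dt)\<^sup>2 + (u (\<sigma> r) * ds)\<^sup>2"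
      using P by (simp add: sol_metric_exp c_def c'_def flip: P_def)
        (simp add: field_simps power2_eq_square)
    also have "\<dots> = A\<^sup>2 + B\<^sup>2 + 2 * (v (\<sigma> r) * ds) * (b / P * dt) + ((u (\<sigma> r))\<^sup>2 + (v (\<sigma> r))\<^sup>2) * ds\<^sup>2"
      by (simp add: A_def B_def power_mult_distrib power_divide power2_sum algebra_simps)
    also have "\<dots> = A\<^sup>2 + B\<^sup>2 + 2 * (v (\<sigma> r) * ds) * (b / P * dt) + \<bar>ds\<bar>\<^sup>2"
      by (simp add: unit)
    finally have metric: "sol_metric (c r) (c' r) (c' r) =
        A\<^sup>2 + B\<^sup>2 + 2 * (v (\<sigma> r) * ds) * (b / P * dt) + \<bar>ds\<bar>\<^sup>2" .
    have "(v (\<sigma> r) * ds) * (b / P * dt) \<le> \<bar>ds\<bar> * B"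
    proof -
      have "(v (\<sigma> r) * ds) * (b / P * dt) \<le> \<bar>(v (\<sigma> r) * ds) * (b / P * dt)\<bar>"
        by (rule abs_ge_self)
      also have "\<dots> = \<bar>v (\<sigma> r)\<bar> * (\<bar>ds\<bar> * B)"
        using P by (simp add: abs_mult B_def)
      also have "\<dots> \<le> 1 * (\<bar>ds\<bar> * B)"
        using P v1 by (intro mult_right_mono) (auto simp: B_def)
      finally show ?thesis by simp
    qed
    then have "sol_metric (c r) (c' r) (c' r) \<le> A\<^sup>2 + B\<^sup>2 + 2 * (\<bar>ds\<bar> * B) + \<bar>ds\<bar>\<^sup>2"
      unfolding metric mult.assoc[of 2] by (intro add_mono mult_left_mono order_refl) auto
    also have "\<dots> \<le> (\<bar>ds\<bar> + (A + B))\<^sup>2"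
    proof -
      have "0 \<le> A" "0 \<le> B" using P by (auto simp: A_def B_def)
      then show ?thesis by (simp add: power2_sum algebra_simps)
    qed
    finally have "speed c r \<le> \<bar>ds\<bar> + (A + B)"
      unfolding speed using P by (intro real_le_lsqrt) (auto simp: A_def B_def sol_metric_nonneg)
    with AB show ?thesis by (simp add: L_def)
  qed
  have "c \<in> connecting_paths M (\<Psi> p) (\<Psi> q)"
    unfolding connecting_paths_def
  proof (intro CollectI conjI int)
    have "c C1_differentiable_on {0..1}"
      unfolding C1_differentiable_on_def using dc cc' by blast
    then show "valid_path c"
      unfolding valid_path_def by (rule C1_differentiable_imp_piecewise)
    show "path_image c \<subseteq> M"
      using a by (auto simp: path_image_def c_def in_M_iff)
    show "pathstart c = \<Psi> p" "pathfinish c = \<Psi> q"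
      by (simp_all add: pathstart_def pathfinish_def c_def \<Psi>_eq' \<sigma>_def ds_def dt_def)
  qed
  then have "induced_dist M (\<Psi> p) (\<Psi> q) \<le> ereal (integral {0..1} (speed c))"
    unfolding induced_dist_def by (rule INF_lower)
  moreover have "integral {0..1} (speed c) \<le> integral {0..1} (\<lambda>r::real. L)"
    using int speed_le by (intro Henstock_Kurzweil_Integration.integral_le) auto
  ultimately have "induced_dist M (\<Psi> p) (\<Psi> q) \<le> ereal L"
    by (auto intro: order_trans)
  then show ?thesis
    by (simp add: L_def ds_def dt_def)
qed

end

section \<open>Graph and completeness\<close>

lemma partial_cong:
  assumes "open U" "u \<in> U" and eq: "\<And>p. p \<in> U \<Longrightarrow> f p = g p"
  shows "((\<lambda>h. f (u + h *\<^sub>R axis i 1)) has_vector_derivative d) (at 0) \<longleftrightarrow>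
    ((\<lambda>h. g (u + h *\<^sub>R axis i 1)) has_vector_derivative d) (at 0)"
    and "partial i f u = partial i g u"
proof -
  define T where "T = (\<lambda>h. u + h *\<^sub>R axis i 1) -` U"
  have T: "open T" "0 \<in> T"
    unfolding T_def using assms(1,2) by (auto intro!: open_vimage continuous_intros)
  have f_eq: "f (u + h *\<^sub>R axis i 1) = g (u + h *\<^sub>R axis i 1)" if "h \<in> T" for h
    using that eq by (auto simp: T_def)
  show iff: "((\<lambda>h. f (u + h *\<^sub>R axis i 1)) has_vector_derivative d) (at 0) \<longleftrightarrow>
      ((\<lambda>h. g (u + h *\<^sub>R axis i 1)) has_vector_derivative d) (at 0)" for d
    using has_vector_derivative_transform_within_open[OF _ T] f_eq
    by (metis (no_types, lifting))
  show "partial i f u = partial i g u"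
    unfolding partial_def vector_derivative_def iff ..
qed

lemma C1_on_cong:
  assumes "open U" and eq: "\<And>p. p \<in> U \<Longrightarrow> f p = g p"
  shows "C1_on U f \<longleftrightarrow> C1_on U g"
proof -
  have "continuous_on U (partial i f) \<longleftrightarrow> continuous_on U (partial i g)" for i
    by (intro continuous_on_cong refl partial_cong(2)[OF assms(1) _ eq])
  moreover have "((\<lambda>h. f (p + h *\<^sub>R axis i 1)) has_vector_derivative d) (at 0) \<longleftrightarrow>
      ((\<lambda>h. g (p + h *\<^sub>R axis i 1)) has_vector_derivative d) (at 0)" if "p \<in> U" for p i d
    by (rule partial_cong(1)[where f = f and g = g, OF assms(1) that eq])
  ultimately show ?thesis
    unfolding C1_on_def differentiable_iff_has_vector_derivative by simp
qed

text \<open>This shape covers the graph function, with \<open>c = b / a\<close>, as well as its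
  partial derivatives, with \<open>c = 0\<close>.\<close>

lemma C1_on_height:
  fixes \<phi> :: "real \<Rightarrow> real" and c :: real
  assumes "\<And>t. t \<in> J \<Longrightarrow> (\<phi> has_real_derivative \<phi>' t) (at t)" and "continuous_on J \<phi>'"
  defines "f \<equiv> \<lambda>p::real^2. \<phi> (p $ 2) + c * p $ 1"
  shows "C1_on {p. p $ 2 \<in> J} f"
    and "\<And>p. partial 1 f p = c" "\<And>p. p $ 2 \<in> J \<Longrightarrow> partial 2 f p = \<phi>' (p $ 2)"
proof -
  have d1: "((\<lambda>h. f (p + h *\<^sub>R axis 1 1)) has_vector_derivative c) (at 0)" for p
    unfolding f_def has_real_derivative_iff_has_vector_derivative[symmetric]
    by (auto simp: axis_def intro!: derivative_eq_intros)
  have d2: "((\<lambda>h. f (p + h *\<^sub>R axis 2 1)) has_vector_derivative \<phi>' (p $ 2)) (at 0)" if "p $ 2 \<in> J" for p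
  proof -
    have "((\<lambda>h. \<phi> (p $ 2 + h) + c * p $ 1) has_vector_derivative \<phi>' (p $ 2)) (at 0)"
      unfolding has_vector_derivative_shift_0
      using assms(1)[OF that] by (simp add: has_real_derivative_iff_has_vector_derivative)
    then show ?thesis
      by (simp add: f_def axis_def)
  qed
  show p1: "partial 1 f p = c" for p
    unfolding partial_def by (rule vector_derivative_at[OF d1])
  show p2: "partial 2 f p = \<phi>' (p $ 2)" if "p $ 2 \<in> J" for p
    unfolding partial_def by (rule vector_derivative_at[OF d2[OF that]])
  have "continuous_on {p. p $ 2 \<in> J} (\<lambda>p. \<phi>' (p $ 2))"
    by (rule continuous_on_compose2[OF assms(2)]) (auto intro!: continuous_intros)
  then have "continuous_on {p. p $ 2 \<in> J} (partial 2 f)"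
    by (subst continuous_on_cong[OF refl p2]) auto
  moreover have "continuous_on {p. p $ 2 \<in> J} (partial 1 f)"
    by (simp add: p1)
  ultimately show "C1_on {p. p $ 2 \<in> J} f"
    unfolding C1_on_def forall_2 differentiable_iff_has_vector_derivative using d1 d2 by auto
qed

context transversal_profile
begin

lemma graph: "graph_over_xz M"
proof -
  define \<Omega> :: "(real^2) set" where "\<Omega> = {p. p $ 2 \<in> range z}"
  define \<phi> where "\<phi> t = y (height_inv t)" for t
  define \<phi>' where "\<phi>' t = exp t * v (height_inv t) / u (height_inv t)" for t
  \<comment> \<open>The cube arises because the quotient rule yields \<open>u\<^sup>2\<close> and
    the inner derivative of \<open>height_inv\<close> another \<open>1 / u\<close>.\<close>
  define \<phi>'' where "\<phi>'' t = exp t * (v (height_inv t) / u (height_inv t) +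
    (v' (height_inv t) * u (height_inv t) - v (height_inv t) * u' (height_inv t)) / u (height_inv t) ^ 3)" for t
  define F where "F p = \<phi> (p $ 2) + b / a * p $ 1" for p :: "real^2"
  have \<Omega>: "open \<Omega>"
  proof -
    have "\<Omega> = (\<lambda>p. p $ 2) -` range z"
      by (auto simp: \<Omega>_def)
    then show ?thesis
      using open_range_z by (auto intro!: open_vimage continuous_intros)
  qed
  have inv_deriv: "(height_inv has_real_derivative 1 / u (height_inv t)) (at t)" if "t \<in> range z" for t
    using that height_inv_deriv by auto
  have c_inv: "continuous_on (range z) height_inv"
    using DERIV_isCont[OF inv_deriv] by (simp add: continuous_at_imp_continuous_on)
  have comp: "continuous_on (range z) (\<lambda>t. f (height_inv t))" if "continuous_on UNIV f" for f :: "real \<Rightarrow> real"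
    by (rule continuous_on_compose2[OF that c_inv]) auto
  have \<phi>: "(\<phi> has_real_derivative \<phi>' t) (at t)" if t: "t \<in> range z" for t
  proof -
    have "z (height_inv t) = t"
      using t by auto
    with DERIV_chain2[OF dy inv_deriv[OF t]] show ?thesis
      by (simp add: \<phi>_def[abs_def] \<phi>'_def)
  qed
  have \<phi>': "(\<phi>' has_real_derivative \<phi>'' t) (at t)" if t: "t \<in> range z" for t
  proof -
    note du = DERIV_chain2[OF du[OF UNIV_I] inv_deriv[OF t]]
      and dv = DERIV_chain2[OF dv[OF UNIV_I] inv_deriv[OF t]]
    show ?thesis
      unfolding \<phi>'_def[abs_def]
      by (rule DERIV_cong[OF DERIV_divide[OF DERIV_mult[OF DERIV_exp dv] du u_nonzero]])
        (simp add: \<phi>''_def u_nonzero field_simps power3_eq_cube)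
  qed
  have c\<phi>'': "continuous_on (range z) \<phi>''"
    unfolding \<phi>''_def by (intro continuous_intros comp continuous_on_derivs cu' cv') (simp_all add: u_nonzero)
  have c\<phi>': "continuous_on (range z) \<phi>'"
    using DERIV_isCont[OF \<phi>'] by (simp add: continuous_at_imp_continuous_on)
  note F = C1_on_height[OF \<phi> c\<phi>', where c = "b / a", folded F_def \<Omega>_def]
  note F' = C1_on_height(1)[OF \<phi>' c\<phi>'', where c = 0, folded \<Omega>_def]
  have const: "C1_on \<Omega> (\<lambda>p. b / a)"
    using C1_on_height(1)[of "range z" "\<lambda>t. b / a" "\<lambda>t. 0" 0] by (simp add: \<Omega>_def)
  have p2: "partial 2 F p = \<phi>' (p $ 2) + 0 * p $ 1" if "p \<in> \<Omega>" for p
    using F(3) that by (simp add: \<Omega>_def)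
  have "C2_on \<Omega> F"
    unfolding C2_on_def forall_2
  proof (intro conjI)
    show "C1_on \<Omega> F"
      by (rule F(1))
    have "partial 1 F = (\<lambda>p. b / a)"
      by (rule ext) (rule F(2))
    with const show "C1_on \<Omega> (partial 1 F)"
      by simp
    show "C1_on \<Omega> (partial 2 F)"
      using F' C1_on_cong[where f = "partial 2 F" and g = "\<lambda>p. \<phi>' (p $ 2) + 0 * p $ 1", OF \<Omega> p2]
      by simp
  qed
  moreover have "M = (\<lambda>u. vector [u $ 1, F u, u $ 2]) ` \<Omega>"
  proof (intro equalityI subsetI)
    fix p assume p: "p \<in> M"
    show "p \<in> (\<lambda>u. vector [u $ 1, F u, u $ 2]) ` \<Omega>"
    proof
      show "vector [p $ 1, p $ 3] \<in> \<Omega>"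
        using in_M(1)[OF p] by (auto simp: \<Omega>_def)
      show "p = vector [vector [p $ 1, p $ 3] $ (1::2), F (vector [p $ 1, p $ 3]), vector [p $ 1, p $ 3] $ (2::2)]"
        using in_M(2)[OF p] by (simp add: F_def \<phi>_def vec_eq_iff forall_3)
    qed
  next
    fix p :: "real^3" assume "p \<in> (\<lambda>u. vector [u $ 1, F u, u $ 2]) ` \<Omega>"
    then show "p \<in> M"
      unfolding in_M_iff by (auto simp: F_def \<phi>_def \<Omega>_def)
  qed
  ultimately show ?thesis
    unfolding graph_over_xz_def using \<Omega> by blast
qed

lemma complete: "complete_surface M"
  unfolding complete_surface_def
proof (intro allI impI, elim conjE)
  fix \<sigma> :: "nat \<Rightarrow> real^3"
  assume M: "\<forall>n. \<sigma> n \<in> M"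
    and Cauchy: "\<forall>e>0. \<exists>N. \<forall>m\<ge>N. \<forall>n\<ge>N. induced_dist M (\<sigma> m) (\<sigma> n) < ereal e"
  define s where "s n = height_inv (\<sigma> n $ 3)" for n
  define x where "x n = \<sigma> n $ 1" for n
  have short_path: "\<exists>c\<in>connecting_paths M p q. integral {0..1} (speed c) < e"
    if "induced_dist M p q < ereal e" for p q e
    using that unfolding induced_dist_def by (auto simp: INF_less_iff)
  obtain N1 where N1: "\<And>m n. m \<ge> N1 \<Longrightarrow> n \<ge> N1 \<Longrightarrow> induced_dist M (\<sigma> m) (\<sigma> n) < ereal 1"
    using Cauchy[rule_format, of 1] by auto
  \<comment> \<open>The tail of the sequence stays within height 1 of \<open>\<sigma> N1\<close>,
    and a path of length below 1 starting there gains at most 1 more. The cap in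
    \<open>min e 1\<close> below keeps the chosen paths that short.\<close>
  define R where "R = \<bar>\<sigma> N1 $ 3\<bar> + 2"
  have R: "\<bar>\<sigma> n $ 3\<bar> \<le> R - 1" if n: "n \<ge> N1" for n
  proof -
    obtain c where c: "c \<in> connecting_paths M (\<sigma> N1) (\<sigma> n)" "integral {0..1} (speed c) < 1"
      using short_path[OF N1[OF order_refl n]] by blast
    have "c 1 = \<sigma> n"
      using c(1) by (simp add: connecting_paths_def pathfinish_def)
    with connecting_path_height_le[OF c(1), of 1] c(2) show ?thesis
      by (simp add: R_def)
  qed
  define C where "C = max (exp R) (2 + \<bar>b / a\<bar> * exp (2 * R))"
  have C0: "0 < C"
    by (simp add: C_def less_max_iff_disj)
  have C: "\<exists>N. \<forall>m\<ge>N. \<forall>n\<ge>N. \<bar>s n - s m\<bar> < C * e \<and> \<bar>x n - x m\<bar> < C * e" if e: "0 < e" for e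
  proof -
    from e obtain N where N: "\<And>m n. m \<ge> N \<Longrightarrow> n \<ge> N \<Longrightarrow> induced_dist M (\<sigma> m) (\<sigma> n) < ereal (min e 1)"
      using Cauchy[rule_format, of "min e 1"] by auto
    show ?thesis
    proof (intro exI[of _ "max N N1"] allI impI)
      fix m n assume mn: "max N N1 \<le> m" "max N N1 \<le> n"
      obtain c where c: "c \<in> connecting_paths M (\<sigma> m) (\<sigma> n)" "integral {0..1} (speed c) < min e 1"
        using short_path[OF N, of m n] mn by auto
      have cR: "\<bar>c t $ 3\<bar> \<le> R" if "t \<in> {0..1}" for t
        using connecting_path_height_le[OF c(1) that] c(2) R[of m] mn by auto
      have le: "D * integral {0..1} (speed c) < C * e" if D: "D \<le> C" "0 < D" for D
      proof -
        have "D * integral {0..1} (speed c) < D * e"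
          using c(2) D by simp
        also have "\<dots> \<le> C * e"
          using D e by (intro mult_right_mono) auto
        finally show ?thesis .
      qed
      show "\<bar>s n - s m\<bar> < C * e \<and> \<bar>x n - x m\<bar> < C * e"
      proof
        have "0 < 2 + \<bar>b / a\<bar> * exp (2 * R)"
          by (intro add_pos_nonneg) auto
        then show "\<bar>s n - s m\<bar> < C * e"
          unfolding s_def by (intro order_le_less_trans[OF connecting_path_parameter_le[OF c(1) cR] le]) (auto simp: C_def)
        show "\<bar>x n - x m\<bar> < C * e"
          unfolding x_def by (intro order_le_less_trans[OF connecting_path_x_le[OF c(1) cR] le]) (auto simp: C_def)
      qed
    qed
  qed
  have small: "\<exists>N. \<forall>m\<ge>N. \<forall>n\<ge>N. \<bar>s n - s m\<bar> < e \<and> \<bar>x n - x m\<bar> < e" if "0 < e" for e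
    using C[of "e / C"] C0 that by simp
  have "Cauchy s" "Cauchy x"
    unfolding Cauchy_def dist_real_def using small by (meson abs_minus_commute)+
  then obtain s0 x0 where lim: "s \<longlonglongrightarrow> s0" "x \<longlonglongrightarrow> x0"
    by (metis Cauchy_convergent_iff convergent_def)
  define q :: "nat \<Rightarrow> real^2" where "q n = vector [s n, x n / a]" for n
  define q0 :: "real^2" where "q0 = vector [s0, x0 / a]"
  have \<sigma>: "\<sigma> n = \<Psi> (q n)" for n
    using in_M[OF M[rule_format, of n]] a by (simp add: \<Psi>_eq' q_def s_def x_def vec_eq_iff forall_3)
  have "bounded (z ` {s0 - 1..s0 + 1})"
    \<comment> \<open>Every real \<open>s0\<close> is a parameter of the profile, so
      \<open>z\<close> is continuous and bounded around it; the paths to the limit point run over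
      this interval.\<close>
    by (intro compact_imp_bounded compact_continuous_image continuous_on_subset[OF continuous_on_derivs(2)]) auto
  then obtain R0 where R0: "\<And>t. t \<in> {s0 - 1..s0 + 1} \<Longrightarrow> \<bar>z t\<bar> \<le> R0"
    by (auto simp: bounded_iff simp del: atLeastAtMost_iff)
  define d where "d n = \<bar>s0 - s n\<bar> + (\<bar>a\<bar> + \<bar>b\<bar>) * exp R0 * \<bar>x0 / a - x n / a\<bar>" for n
  have "d \<longlonglongrightarrow> \<bar>s0 - s0\<bar> + (\<bar>a\<bar> + \<bar>b\<bar>) * exp R0 * \<bar>x0 / a - x0 / a\<bar>"
    unfolding d_def by (intro tendsto_intros lim a)
  then have d: "(\<lambda>n. ereal (d n)) \<longlonglongrightarrow> 0"
    by (simp add: zero_ereal_def)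
  have "\<forall>\<^sub>F n in sequentially. s n \<in> ball s0 1"
    using lim(1) by (rule topological_tendstoD) auto
  then have le: "\<forall>\<^sub>F n in sequentially. induced_dist M (\<sigma> n) (\<Psi> q0) \<le> ereal (d n)"
  proof eventually_elim
    case (elim n)
    have "closed_segment (s n) s0 \<subseteq> {s0 - 1..s0 + 1}"
      using elim by (intro closed_segment_subset) (auto simp: dist_real_def)
    then have "\<bar>z t\<bar> \<le> R0" if "t \<in> closed_segment (q n $ 1) (q0 $ 1)" for t
      using R0[of t] that by (auto simp: q_def q0_def)
    from induced_dist_le[of "q n" q0 R0, OF this] show ?case
      by (simp add: \<sigma> q_def q0_def d_def)
  qed
  have "(\<lambda>n. induced_dist M (\<sigma> n) (\<Psi> q0)) \<longlonglongrightarrow> 0"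
    by (rule tendsto_sandwich[OF _ le tendsto_const d]) (simp add: induced_dist_nonneg)
  moreover have "\<Psi> q0 \<in> M"
    unfolding M_def strip_def by blast
  ultimately show "\<exists>p\<in>M. (\<lambda>n. induced_dist M (\<sigma> n) p) \<longlonglongrightarrow> 0"
    by blast
qed

end

section \<open>Dichotomy between stationary and transversal profiles\<close>

theorem theorem1p2:
  fixes a b :: real and V :: "real^3 \<Rightarrow> real^3"
    and I :: "real set" and \<gamma> :: "real \<Rightarrow> real^3" and M :: "(real^3) set"
  assumes "killing_field V"
    and "maximal_profile a b V I \<gamma>"
    and "M = orbit_surface a b \<gamma> ` strip I"
    and "0 \<in> M"
    and "a * b \<noteq> 0"
  shows "(M = {p. p $ 3 = 0} \<and>
            minimal_surface (strip I) (orbit_surface a b \<gamma>) \<and>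
            tangent_along V (strip I) (orbit_surface a b \<gamma>)) \<or>
         (complete_surface M \<and> graph_over_xz M)"
proof -
  obtain c1 c2 c3 where V: "\<And>q. V q = c1 *\<^sub>R F1 q + c2 *\<^sub>R F2 q + c3 *\<^sub>R F3 q"
    using assms(1) unfolding killing_field_def by blast
  obtain y z u v u' v' k where I: "I = UNIV" and c3: "c3 = 0"
    and fr: "framed_profile a b UNIV \<gamma> y z u v u' v'"
    and ode: "\<And>s. ((\<lambda>s. (z s, u s, v s)) has_vector_derivative frame_field a b k (z s, u s, v s)) (at s)"
    by (rule maximal_profile_global[OF V assms(2,5)]) (rule that)
  interpret framed_profile a b UNIV \<gamma> y z u v u' v'
    by (rule fr)
  show ?thesis
  proof (cases "\<exists>r. u r = 0")
    case False
    then interpret transversal_profile a b \<gamma> y z u v u' v'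
      by unfold_locales auto
    have "M = transversal_profile.M a b \<gamma>"
      using assms(3) I by (simp add: M_def)
    then show ?thesis
      using graph complete by simp
  next
    case True
    then obtain r where r: "u r = 0" by blast
    \<comment> \<open>The constant curve also solves the system, because the whole field vanishes at
      \<open>u = 0\<close>.\<close>
    have "(z s, u s, v s) = (z r, 0, v r)" for s
    proof (rule ode_unique[where H = "frame_field a b k" and J = UNIV and r = r
          and x = "\<lambda>s. (z s, u s, v s)" and w = "\<lambda>s. (z r, 0, v r)"])
      have "frame_field a b k (z r, 0, v r) = 0"
        by (simp add: frame_field_def angular_speed_def zero_prod_def)
      then show "((\<lambda>s. (z r, 0, v r)) has_vector_derivative frame_field a b k (z r, 0, v r)) (at t)" for t
        by simp
    qed (use frame_field_lipschitz[OF assms(5)] ode r in \<open>simp_all add: is_interval_univ\<close>)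
    then have u0: "u s = 0" and z: "z s = z r" and v: "v s = v r" for s
      by auto
    have vr: "v r \<noteq> 0"
      using unit[of r] u0 by auto
    obtain p0 where "\<Psi> p0 = 0"
      using assms(3,4) by auto
    then have "z (p0 $ 1) = 0"
      by (auto simp: \<Psi>_eq vec_eq_iff forall_3)
    then have z0: "z s = 0" for s
      using z[of "p0 $ 1"] z[of s] by simp
    have y: "y s = y r + v r * (s - r)" for s
    proof -
      have "norm ((y s - v r * s) - (y r - v r * r)) \<le> 0 * norm (s - r)"
      proof (rule field_differentiable_bound[of UNIV "\<lambda>s. y s - v r * s" "\<lambda>s. 0"])
        show "((\<lambda>s. y s - v r * s) has_real_derivative 0) (at t within UNIV)" for t
          using v[of t] by (auto intro!: derivative_eq_intros dy simp: z0)
      qed auto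
      then show ?thesis
        by (simp add: algebra_simps)
    qed
    have "M = {p. p $ 3 = 0}"
    proof (intro equalityI subsetI)
      fix p assume "p \<in> M"
      then show "p \<in> {p. p $ 3 = 0}"
        using assms(3) by (auto simp: I \<Psi>_eq z0)
    next
      fix p :: "real^3" assume "p \<in> {p. p $ 3 = 0}"
      then have p3: "p $ 3 = 0" by simp
      define t where "t = p $ 1 / a"
      \<comment> \<open>The profile is a line traversed with velocity \<open>v r \<noteq> 0\<close>
        for all times, so it can be solved for any prescribed y-coordinate.\<close>
      define s where "s = r + (p $ 2 - b * t - y r) / v r"
      have "y s = p $ 2 - b * t"
        unfolding y[of s] by (simp add: s_def vr)
      then have "p = \<Psi> (vector [s, t])"
        using p3 a by (simp add: \<Psi>_eq z0 vec_eq_iff forall_3 t_def)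
      then show "p \<in> M"
        unfolding assms(3) I strip_def by blast
    qed
    moreover have "minimal_surface (strip I) \<Psi>"
    proof -
      have "u' s = 0" "v' s = 0" for s
      proof -
        have "(u has_real_derivative 0) (at s)" "(v has_real_derivative 0) (at s)"
          by (rule has_field_derivative_transform_within_open[OF DERIV_const open_UNIV UNIV_I],
              rule u0[symmetric] v[symmetric])+
        then show "u' s = 0" "v' s = 0"
          using du[of s] dv[of s] DERIV_unique by blast+
      qed
      \<comment> \<open>A minimal surface is a translator for the zero Killing field, so the
        criterion already proved applies.\<close>
      then have "translator (\<lambda>q. 0 *\<^sub>R F1 q + 0 *\<^sub>R F2 q + 0 *\<^sub>R F3 q) (strip UNIV) \<Psi>"
        unfolding translator_iff[OF refl] translator_eq_def by (simp add: u0)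
      then show ?thesis
        by (simp add: translator_def minimal_surface_def I sol_metric_def)
    qed
    moreover have "tangent_along V (strip I) \<Psi>"
      unfolding tangent_along_def
    proof
      fix p
      \<comment> \<open>At height 0 the tangent vectors are (0, \<open>v r\<close>, 0) and (a, b,
        0), and with \<open>c3 = 0\<close> the field is (c1, c2, 0); the coefficients solve this
        triangular system.\<close>
      have eq: "V (\<Psi> p) = ((c2 - b * c1 / a) / v r) *\<^sub>R partial 1 \<Psi> p + (c1 / a) *\<^sub>R partial 2 \<Psi> p"
        using a vr
        by (simp add: V c3 F1_def F2_def partial_orbit_surface vector_derivative_\<gamma> z0 u0 v[of "p $ 1"]
            vec_eq_iff forall_3)
      show "V (\<Psi> p) \<in> span (range (\<lambda>i. partial i \<Psi> p))"
        unfolding eq by (intro span_add span_scale span_base rangeI)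
    qed
    ultimately show ?thesis
      by blast
  qed
qed

end
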